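(* Let $B_s^{(1)}$ be the set of all 1-ary $S_{11}$-statements and $\Omega_s^{(1)}$ the set of all 1-ary $S_{11}$-theorems. Then $B_s^{(1)}$ and $\Omega_s^{(1)}$ are recursively enumerable, but the complement $\overline{\Omega}_s^{(1)} = B_s^{(1)} \setminus \Omega_s^{(1)}$ is not recursively enumerable.
   Context: A recursive system $S=[A_S;P_S;B_S]$ consists of a finite alphabet $A_S$ of constant/operation symbols, a finite alphabet $P_S$ of predicate symbols, a denumerable set $X$ of variables, and a finite list $B_S$ of basis R-axioms, which are R-formulas of the form $\to F_1 \to F_2 \dots \to F_k\, G$ ($k\ge 0$) built from prime R-formulas ($p\,\lambda_1,\dots,\lambda_n$ with $p\in P_S$ and lists $\lambda_i$ built from symbols of $A_S$, variables and $f(\lambda)$ for $f\in A_S$; or equations $\sim\lambda,\mu$). R-derivable formulas are generated from the basis R-axioms and the R-axioms of equality by Modus Ponens and substitution of lists for variables. A set/relation of strings (elementary lists) is recursively enumerable if it equals $\{(\lambda_1,\dots,\lambda_n): p\,\lambda_1,\dots,\lambda_n \text{ is R-derivable in } S\}$ for some recursive system $S$ and some $p\in P_S$. Every recursive system $S$ (with ordered alphabets $A_S=[a_1;\dots;a_k]$, $P_S=[p_1;\dots;p_l]$, variables $x_1,x_2,\dots$, and ordered basis R-axioms $F_1,\dots,F_m$) is encoded over the 11-symbol alphabet $A_{11}$ consisting of $a$, $v$, $p$, $\Box$, the accent $'$, $*$, and underlined copies of $\sim$, $($, $)$, the comma and $\to$: the $i$-th constant becomes $a$ followed by $i$ accents,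 the $i$-th predicate symbol $p$ followed by $i$ accents, the $i$-th variable $v$ followed by $i$ accents, and the symbols $\sim,(,),\text{comma},\to$ become their underlined copies. The R-basis string of $S$ is $\tilde S = u*w*\tilde F_1*\dots*\tilde F_m*$ (or $u*w*\Box*$ if $m=0$), where $u$ (resp. $w$) is $\Box$ if $k=0$ (resp. $l=0$) and otherwise a string of $k$ (resp. $l$) accents. There is a fixed universal recursive system $S_{11}$ with constant alphabet $A_{11}$ containing a 1-ary predicate $\Omega_s$ such that $\Omega_s\, yx$ is R-derivable in $S_{11}$ iff $y$ is an R-basis string of a recursive system $S$ and $x$ encodes an elementary (variable-free) prime R-formula that is R-derivable in $S$. An $S_{11}$-statement is a string $z=yx$ over $A_{11}$ where $y$ is an R-basis string representing a recursive system $S$ and $x$ encodes an elementary prime R-formula (not necessarily of $S$); it is an $S_{11}$-theorem if moreover $\Omega_s\, yx$ is R-derivable in $S_{11}$. The statement is called 1-ary if the encoded prime R-formula has exactly one argument list. *)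

theory Defs
  imports Main
begin

text \<open>
  The pool from which the alphabets \<open>A_S\<close> are drawn: the eleven symbols of
  \<open>A\<^sub>1\<^sub>1\<close> and infinitely many further ones. Predicate symbols and
  variables are numbered; the variable \<open>x\<^sub>1\<close> is \<open>Var 0\<close>.
\<close>

datatype csym =
    Sym_a | Sym_v | Sym_p | Box | Accent | Star
  | U_Sim | U_LPar | U_RPar | U_Comma | U_Arrow
  | Other nat

definition A11 :: "csym list" where
  "A11 = [Sym_a, Sym_v, Sym_p, Box, Accent, Star, U_Sim, U_LPar, U_RPar, U_Comma, U_Arrow]"

text \<open>
  A list is a nonempty juxtaposition of items; \<open>App f l\<close> stands for \<open>f(l)\<close>.
  Predicate symbols carry no fixed arity.
\<close>

datatype item = Con csym | Var nat | App csym "item list"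

datatype prime_rf = Equ "item list" "item list" | Pred nat "item list list"

datatype rformula = Prime prime_rf | Imp prime_rf rformula

record recsys =
  alph :: "csym list"
  prds :: "nat list"
  basis :: "rformula list"

fun item_over :: "csym set \<Rightarrow> item \<Rightarrow> bool" where
  "item_over A (Con c) \<longleftrightarrow> c \<in> A"
| "item_over A (Var x) \<longleftrightarrow> True"
| "item_over A (App f l) \<longleftrightarrow> f \<in> A \<and> l \<noteq> [] \<and> (\<forall>t\<in>set l. item_over A t)"

definition list_over :: "csym set \<Rightarrow> item list \<Rightarrow> bool" where
  "list_over A l \<longleftrightarrow> l \<noteq> [] \<and> (\<forall>t\<in>set l. item_over A t)"

fun prime_of :: "recsys \<Rightarrow> prime_rf \<Rightarrow> bool" where
  "prime_of S (Equ l m) \<longleftrightarrow> list_over (set (alph S)) l \<and> list_over (set (alph S)) m"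
| "prime_of S (Pred p ls) \<longleftrightarrow> p \<in> set (prds S) \<and> (\<forall>l\<in>set ls. list_over (set (alph S)) l)"

fun rformula_of :: "recsys \<Rightarrow> rformula \<Rightarrow> bool" where
  "rformula_of S (Prime F) \<longleftrightarrow> prime_of S F"
| "rformula_of S (Imp F G) \<longleftrightarrow> prime_of S F \<and> rformula_of S G"

definition recursive_system :: "recsys \<Rightarrow> bool" where
  "recursive_system S \<longleftrightarrow>
     distinct (alph S) \<and> distinct (prds S) \<and> (\<forall>F\<in>set (basis S). rformula_of S F)"

fun elem_item :: "item \<Rightarrow> bool" where
  "elem_item (Con c) \<longleftrightarrow> True"
| "elem_item (Var x) \<longleftrightarrow> False"
| "elem_item (App f l) \<longleftrightarrow> (\<forall>t\<in>set l. elem_item t)"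

definition elem_list :: "item list \<Rightarrow> bool" where
  "elem_list l \<longleftrightarrow> (\<forall>t\<in>set l. elem_item t)"

fun elem_prime :: "prime_rf \<Rightarrow> bool" where
  "elem_prime (Equ l m) \<longleftrightarrow> elem_list l \<and> elem_list m"
| "elem_prime (Pred p ls) \<longleftrightarrow> (\<forall>l\<in>set ls. elem_list l)"

fun subst_item :: "nat \<Rightarrow> item list \<Rightarrow> item \<Rightarrow> item list" where
  "subst_item x m (Con c) = [Con c]"
| "subst_item x m (Var y) = (if y = x then m else [Var y])"
| "subst_item x m (App f l) = [App f (concat (map (subst_item x m) l))]"

definition subst_list :: "nat \<Rightarrow> item list \<Rightarrow> item list \<Rightarrow> item list" where
  "subst_list x m l = concat (map (subst_item x m) l)"

fun subst_prime :: "nat \<Rightarrow> item list \<Rightarrow> prime_rf \<Rightarrow> prime_rf" where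
  "subst_prime x m (Equ l k) = Equ (subst_list x m l) (subst_list x m k)"
| "subst_prime x m (Pred p ls) = Pred p (map (subst_list x m) ls)"

fun subst_rf :: "nat \<Rightarrow> item list \<Rightarrow> rformula \<Rightarrow> rformula" where
  "subst_rf x m (Prime F) = Prime (subst_prime x m F)"
| "subst_rf x m (Imp F G) = Imp (subst_prime x m F) (subst_rf x m G)"

text \<open>
  The R-axioms of equality are reflexivity \<open>\<sim>x,x\<close> and the replacement axioms
  \<open>\<rightarrow> \<sim>x,y \<rightarrow> F F(y/x)\<close> for prime R-formulas \<open>F\<close> of the system. Symmetry,
  transitivity and the congruence laws for concatenation, \<open>f(\<cdot>)\<close> and the predicate
  symbols follow from these by substitution and Modus Ponens.
\<close>

inductive R_derivable :: "recsys \<Rightarrow> rformula \<Rightarrow> bool" for S :: recsys where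
  basis_axiom: "F \<in> set (basis S) \<Longrightarrow> R_derivable S F"
| eq_refl: "R_derivable S (Prime (Equ [Var x] [Var x]))"
| eq_repl: "prime_of S F \<Longrightarrow>
    R_derivable S (Imp (Equ [Var x] [Var y]) (Imp F (Prime (subst_prime x [Var y] F))))"
| modus_ponens: "R_derivable S (Prime F) \<Longrightarrow> R_derivable S (Imp F G) \<Longrightarrow> R_derivable S G"
| substitution: "R_derivable S F \<Longrightarrow> list_over (set (alph S)) m \<Longrightarrow> R_derivable S (subst_rf x m F)"

definition recursively_enumerable :: "nat \<Rightarrow> item list list set \<Rightarrow> bool" where
  "recursively_enumerable n R \<longleftrightarrow>
     (\<exists>S p. recursive_system S \<and> p \<in> set (prds S) \<and>
        R = {ls. length ls = n \<and> (\<forall>l\<in>set ls. elem_list l) \<and> R_derivable S (Prime (Pred p ls))})"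

text \<open>A string of symbols is the elementary list made of these constants, without any \<open>App\<close>.\<close>

abbreviation str :: "csym list \<Rightarrow> item list" where
  "str z \<equiv> map Con z"

abbreviation re_strings :: "csym list set \<Rightarrow> bool" where
  "re_strings L \<equiv> recursively_enumerable 1 ((\<lambda>z. [str z]) ` L)"

text \<open>
  The encoding depends only on the position of a symbol in its ordered alphabet:
  \<open>posn xs a\<close> is the position, counted from 1, of the first occurrence of \<open>a\<close> in \<open>xs\<close>.
\<close>

definition posn :: "'a list \<Rightarrow> 'a \<Rightarrow> nat" where
  "posn xs a = Suc (length (takeWhile (\<lambda>b. b \<noteq> a) xs))"

definition accents :: "nat \<Rightarrow> csym list" where
  "accents n = replicate n Accent"

fun code_item :: "recsys \<Rightarrow> item \<Rightarrow> csym list" where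
  "code_item S (Con c) = Sym_a # accents (posn (alph S) c)"
| "code_item S (Var x) = Sym_v # accents (Suc x)"
| "code_item S (App f l) =
     Sym_a # accents (posn (alph S) f) @ [U_LPar] @ concat (map (code_item S) l) @ [U_RPar]"

definition code_list :: "recsys \<Rightarrow> item list \<Rightarrow> csym list" where
  "code_list S l = concat (map (code_item S) l)"

fun code_args :: "recsys \<Rightarrow> item list list \<Rightarrow> csym list" where
  "code_args S [] = []"
| "code_args S [l] = code_list S l"
| "code_args S (l # ls) = code_list S l @ [U_Comma] @ code_args S ls"

fun code_prime :: "recsys \<Rightarrow> prime_rf \<Rightarrow> csym list" where
  "code_prime S (Equ l m) = U_Sim # code_args S [l, m]"
| "code_prime S (Pred p ls) = Sym_p # accents (posn (prds S) p) @ code_args S ls"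

fun code_rf :: "recsys \<Rightarrow> rformula \<Rightarrow> csym list" where
  "code_rf S (Prime F) = code_prime S F"
| "code_rf S (Imp F G) = U_Arrow # code_prime S F @ code_rf S G"

definition tally :: "nat \<Rightarrow> csym list" where
  "tally n = (if n = 0 then [Box] else accents n)"

definition basis_string :: "recsys \<Rightarrow> csym list" where
  "basis_string S =
     tally (length (alph S)) @ [Star] @ tally (length (prds S)) @ [Star] @
     (if basis S = [] then [Box, Star] else concat (map (\<lambda>F. code_rf S F @ [Star]) (basis S)))"

text \<open>
  The defining property of the pair \<open>S\<^sub>1\<^sub>1\<close>, \<open>\<Omega>\<^sub>s\<close>. It is stated for the
  whole string \<open>z = yx\<close>, with the decomposition existentially quantified: a given \<open>z\<close>
  also has decompositions whose first part is not an R-basis string.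
\<close>

definition universal_system :: "recsys \<Rightarrow> nat \<Rightarrow> bool" where
  "universal_system S11 \<Omega> \<longleftrightarrow>
     recursive_system S11 \<and> alph S11 = A11 \<and> \<Omega> \<in> set (prds S11) \<and>
     (\<forall>z. set z \<subseteq> set A11 \<longrightarrow>
        (R_derivable S11 (Prime (Pred \<Omega> [str z])) \<longleftrightarrow>
         (\<exists>y x S F. z = y @ x \<and> recursive_system S \<and> y = basis_string S \<and>
            prime_of S F \<and> elem_prime F \<and> x = code_prime S F \<and> R_derivable S (Prime F))))"

text \<open>
  In an \<open>S\<^sub>1\<^sub>1\<close>-statement the encoded formula need not be one of \<open>S\<close>: it may use
  symbols whose position exceeds the alphabets of \<open>S\<close>. It is therefore taken from an
  arbitrary recursive system \<open>T\<close>, whose alphabets determine its code.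
\<close>

definition statement_of :: "csym list \<Rightarrow> recsys \<Rightarrow> recsys \<Rightarrow> prime_rf \<Rightarrow> bool" where
  "statement_of z S T F \<longleftrightarrow>
     recursive_system S \<and> recursive_system T \<and> prime_of T F \<and> elem_prime F \<and>
     z = basis_string S @ code_prime T F"

definition S11_statements :: "csym list set" where
  "S11_statements = {z. \<exists>S T F. statement_of z S T F}"

definition S11_theorems :: "recsys \<Rightarrow> nat \<Rightarrow> csym list set" where
  "S11_theorems S11 \<Omega> = {z \<in> S11_statements. R_derivable S11 (Prime (Pred \<Omega> [str z]))}"

definition unary_statements :: "csym list set" where
  "unary_statements = {z. \<exists>S T p l. statement_of z S T (Pred p [l])}"

definition unary_theorems :: "recsys \<Rightarrow> nat \<Rightarrow> csym list set" where
  "unary_theorems S11 \<Omega> = unary_statements \<inter> S11_theorems S11 \<Omega>"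

end

theory Submission
  imports Defs
begin

text \<open>
  A derivable formula holds in every Horn model of the axioms, with variables ranging
  over ground lists; this bounds what a system derives from above. An arbitrary system
  can be combined with further rules without interference once its equality has been
  turned into an ordinary predicate. Over \<open>S\<^sub>1\<^sub>1\<close>, the predicate \<open>\<Omega>\<^sub>s\<close> itself recognises
  basis strings. If the complement were represented by a predicate, a system extending
  its system could derive \<open>q z\<close> exactly when the statement that the system with basis
  string \<open>z\<close> derives \<open>q z\<close> lies in the complement; \<open>z\<close> its own basis string is then
  contradictory.
\<close>

section \<open>Ground instances and Horn models\<close>

text \<open>Interference is a real obstacle: replacement axioms act on every predicate of a system,
  so a system that derives an equation between two different words would carry any added predicate
  from one word to the other. Once the old equality is an ordinary predicate, the built-in one can
  be read as identity. As predicates have no fixed arity, full replacement would need infinitely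
  many axioms; but derivable atoms have arities bounded by those in the basis, so finitely many
  suffice. \<open>\<Omega>\<close> accepts only derivable formulas. Basis strings are recognised by
  offering it a formula that every system with a constant derives, \<open>~a_1,a_1\<close>; a system
  without constants has no elementary equation and needs separate treatment. A string determines a
  system only up to the names of its symbols. Unique decoding and invariance under renaming are
  therefore needed before \<open>\<Omega>\<close> can be read as derivability in a given system. The
  diagonal construction needs a representing system whose alphabet contains all of
  \<open>A11\<close>; a nontheorem in which all eleven symbols occur enforces this.\<close>

fun inst_item :: "(nat \<Rightarrow> item list) \<Rightarrow> item \<Rightarrow> item list" where
  "inst_item \<sigma> (Con c) = [Con c]"
| "inst_item \<sigma> (Var y) = \<sigma> y"
| "inst_item \<sigma> (App f l) = [App f (concat (map (inst_item \<sigma>) l))]"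

definition inst_list :: "(nat \<Rightarrow> item list) \<Rightarrow> item list \<Rightarrow> item list" where
  "inst_list \<sigma> l = concat (map (inst_item \<sigma>) l)"

fun inst_prime :: "(nat \<Rightarrow> item list) \<Rightarrow> prime_rf \<Rightarrow> prime_rf" where
  "inst_prime \<sigma> (Equ l k) = Equ (inst_list \<sigma> l) (inst_list \<sigma> k)"
| "inst_prime \<sigma> (Pred p ls) = Pred p (map (inst_list \<sigma>) ls)"

fun inst_rf :: "(nat \<Rightarrow> item list) \<Rightarrow> rformula \<Rightarrow> rformula" where
  "inst_rf \<sigma> (Prime F) = Prime (inst_prime \<sigma> F)"
| "inst_rf \<sigma> (Imp F G) = Imp (inst_prime \<sigma> F) (inst_rf \<sigma> G)"

definition single :: "nat \<Rightarrow> item list \<Rightarrow> nat \<Rightarrow> item list" where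
  "single x m = (\<lambda>y. [Var y])(x := m)"

lemma inst_list_simps [simp]:
  "inst_list \<sigma> [] = []"
  "inst_list \<sigma> (t # l) = inst_item \<sigma> t @ inst_list \<sigma> l"
  "inst_list \<sigma> (l @ m) = inst_list \<sigma> l @ inst_list \<sigma> m"
  by (simp_all add: inst_list_def)

lemma inst_list_str [simp]: "inst_list \<sigma> (str z) = str z"
  by (induction z) auto

lemma inst_item_App [simp]: "inst_item \<sigma> (App f l) = [App f (inst_list \<sigma> l)]"
  by (simp add: inst_list_def)

declare inst_item.simps(3) [simp del]

text \<open>Simultaneous substitutions are closed under composition, single ones are not. Later
  arguments therefore use \<open>inst_item\<close> and its relatives, and the substitution rule
  enters only through \<open>single\<close>.\<close>

lemma subst_item_inst: "subst_item x m t = inst_item (single x m) t"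
  by (induction t) (auto simp: single_def inst_list_def intro!: arg_cong[of _ _ concat])

lemma subst_list_inst: "subst_list x m = inst_list (single x m)"
  by (rule ext) (simp add: subst_list_def inst_list_def subst_item_inst[abs_def])

lemma subst_prime_inst: "subst_prime x m F = inst_prime (single x m) F"
  by (cases F) (simp_all add: subst_list_inst)

lemma subst_rf_inst: "subst_rf x m F = inst_rf (single x m) F"
  by (induction F) (simp_all add: subst_prime_inst)

lemma inst_item_comp: "inst_list \<sigma> (inst_item \<tau> t) = inst_item (\<lambda>y. inst_list \<sigma> (\<tau> y)) t"
proof (induction t)
  case (App f l)
  then have "inst_list \<sigma> (inst_list \<tau> l) = inst_list (\<lambda>y. inst_list \<sigma> (\<tau> y)) l"
    by (induction l) auto
  then show ?case by simp
qed auto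

lemma inst_list_comp: "inst_list \<sigma> (inst_list \<tau> l) = inst_list (\<lambda>y. inst_list \<sigma> (\<tau> y)) l"
  by (induction l) (auto simp: inst_item_comp)

lemma inst_prime_comp: "inst_prime \<sigma> (inst_prime \<tau> F) = inst_prime (\<lambda>y. inst_list \<sigma> (\<tau> y)) F"
  by (cases F) (auto simp: inst_list_comp)

lemma inst_rf_comp: "inst_rf \<sigma> (inst_rf \<tau> F) = inst_rf (\<lambda>y. inst_list \<sigma> (\<tau> y)) F"
  by (induction F) (auto simp: inst_prime_comp)

lemma inst_list_single: "(\<lambda>y. inst_list \<sigma> (single x m y)) = \<sigma>(x := inst_list \<sigma> m)"
  by (auto simp: single_def)

lemma inst_item_elem: "elem_item t \<Longrightarrow> inst_item \<sigma> t = [t]"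
proof (induction t)
  case (App f l)
  then have "inst_list \<sigma> l = l" by (induction l) auto
  then show ?case by simp
qed auto

lemma inst_list_elem: "elem_list l \<Longrightarrow> inst_list \<sigma> l = l"
  by (induction l) (auto simp: elem_list_def inst_item_elem)

lemma inst_prime_elem: "elem_prime F \<Longrightarrow> inst_prime \<sigma> F = F"
  by (cases F) (auto simp: inst_list_elem map_idI)

definition ground_over :: "csym set \<Rightarrow> item list \<Rightarrow> bool" where
  "ground_over A l \<longleftrightarrow> list_over A l \<and> elem_list l"

definition ground_subst :: "csym set \<Rightarrow> (nat \<Rightarrow> item list) \<Rightarrow> bool" where
  "ground_subst A \<sigma> \<longleftrightarrow> (\<forall>x. ground_over A (\<sigma> x))"

lemma ground_over_append:
  "ground_over A l \<Longrightarrow> ground_over A m \<Longrightarrow> ground_over A (l @ m)"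
  by (auto simp: ground_over_def list_over_def elem_list_def)

lemma ground_over_App: "f \<in> A \<Longrightarrow> ground_over A l \<Longrightarrow> ground_over A [App f l]"
  by (auto simp: ground_over_def list_over_def elem_list_def)

lemma ground_over_str: "set z \<subseteq> A \<Longrightarrow> z \<noteq> [] \<Longrightarrow> ground_over A (str z)"
  by (auto simp: ground_over_def list_over_def elem_list_def)

lemma ground_subst_upd: "ground_subst A \<sigma> \<Longrightarrow> ground_over A m \<Longrightarrow> ground_subst A (\<sigma>(x := m))"
  by (auto simp: ground_subst_def)

lemma list_over_inst_list:
  assumes "\<And>x. list_over A (\<sigma> x)" "list_over A l"
  shows "list_over A (inst_list \<sigma> l)"
proof -
  have lst: "list_over A (inst_list \<sigma> l)"
    if "l \<noteq> []" "\<And>t. t \<in> set l \<Longrightarrow> list_over A (inst_item \<sigma> t)" for l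
    using that
  proof (induction l)
    case (Cons t l)
    then show ?case by (cases "l = []") (auto simp: list_over_def)
  qed simp
  have "item_over A t \<Longrightarrow> list_over A (inst_item \<sigma> t)" for t
  proof (induction t)
    case (App f l)
    then have "list_over A (inst_list \<sigma> l)" by (intro lst) auto
    then show ?case using App.prems by (simp add: list_over_def)
  qed (use assms(1) in \<open>auto simp: list_over_def\<close>)
  with assms(2) show ?thesis by (intro lst) (auto simp: list_over_def)
qed

lemma elem_list_inst_list: "(\<And>x. elem_list (\<sigma> x)) \<Longrightarrow> elem_list (inst_list \<sigma> l)"
proof -
  assume \<sigma>: "elem_list (\<sigma> x)" for x
  have "elem_list (inst_item \<sigma> t)" for t
  proof (induction t)
    case (App f l)
    then have "elem_list (inst_list \<sigma> l)" by (induction l) (auto simp: elem_list_def)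
    then show ?case by (simp add: elem_list_def)
  qed (use \<sigma> in \<open>auto simp: elem_list_def\<close>)
  then show ?thesis by (induction l) (auto simp: elem_list_def)
qed

lemma ground_inst_list:
  "ground_subst A \<sigma> \<Longrightarrow> list_over A l \<Longrightarrow> ground_over A (inst_list \<sigma> l)"
  by (simp add: ground_subst_def ground_over_def list_over_inst_list elem_list_inst_list)

lemma ground_inst_item:
  "ground_subst A \<sigma> \<Longrightarrow> item_over A t \<Longrightarrow> ground_over A (inst_item \<sigma> t)"
  using ground_inst_list[of A \<sigma> "[t]"] by (simp add: list_over_def)

section \<open>Truth of R-formulas in a Horn model\<close>

fun horn :: "(prime_rf \<Rightarrow> bool) \<Rightarrow> rformula \<Rightarrow> bool" where
  "horn M (Prime F) \<longleftrightarrow> M F"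
| "horn M (Imp F G) \<longleftrightarrow> (M F \<longrightarrow> horn M G)"

text \<open>Ground form of the replacement axioms: instantiating \<open>F(y/x)\<close> by
  \<open>\<sigma>\<close> amounts to instantiating \<open>F\<close> by
  \<open>\<sigma>(x := \<sigma> y)\<close>.\<close>

definition eq_replacing :: "recsys \<Rightarrow> (prime_rf \<Rightarrow> bool) \<Rightarrow> bool" where
  "eq_replacing S M \<longleftrightarrow> (\<forall>F \<sigma> x y. prime_of S F \<longrightarrow> ground_subst (set (alph S)) \<sigma> \<longrightarrow>
     M (Equ (\<sigma> x) (\<sigma> y)) \<longrightarrow> M (inst_prime \<sigma> F) \<longrightarrow> M (inst_prime (\<sigma>(x := \<sigma> y)) F))"

text \<open>Generality in \<open>\<sigma>\<close> carries the substitution rule: an instance of a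
  substituted formula is an instance of the original formula under an updated ground
  substitution.\<close>

theorem R_derivable_sound:
  assumes "R_derivable S F"
    and basis: "\<And>G \<sigma>. G \<in> set (basis S) \<Longrightarrow> ground_subst (set (alph S)) \<sigma> \<Longrightarrow> horn M (inst_rf \<sigma> G)"
    and refl: "\<And>l. ground_over (set (alph S)) l \<Longrightarrow> M (Equ l l)"
    and repl: "eq_replacing S M"
  shows "ground_subst (set (alph S)) \<sigma> \<Longrightarrow> horn M (inst_rf \<sigma> F)"
  using assms(1)
proof (induction arbitrary: \<sigma>)
  case (basis_axiom F)
  then show ?case using basis by blast
next
  case (eq_refl x)
  then show ?case using refl by (simp add: ground_subst_def)
next
  case (eq_repl F x y)
  then show ?case using repl
    by (auto simp: eq_replacing_def subst_prime_inst inst_prime_comp inst_list_single)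
next
  case (modus_ponens F G)
  then show ?case by fastforce
next
  case (substitution F m x)
  then have "ground_subst (set (alph S)) (\<sigma>(x := inst_list \<sigma> m))"
    by (blast intro: ground_subst_upd ground_inst_list)
  with substitution show ?case
    by (simp add: subst_rf_inst inst_rf_comp inst_list_single)
qed

text \<open>Over an empty alphabet no ground list exists, and truth under all ground substitutions
  would be vacuous. A nonempty alphabet lets \<open>R_derivable_sound\<close> speak about elementary
  formulas.\<close>

lemma exists_ground_subst: "alph S \<noteq> [] \<Longrightarrow> \<exists>\<sigma>. ground_subst (set (alph S)) \<sigma>"
  by (rule exI[of _ "\<lambda>_. [Con (hd (alph S))]"])
     (auto simp: ground_subst_def ground_over_def list_over_def elem_list_def)

corollary R_derivable_sound_elem:
  assumes "R_derivable S (Prime F)" "elem_prime F" "alph S \<noteq> []"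
    and "\<And>G \<sigma>. G \<in> set (basis S) \<Longrightarrow> ground_subst (set (alph S)) \<sigma> \<Longrightarrow> horn M (inst_rf \<sigma> G)"
    and "\<And>l. ground_over (set (alph S)) l \<Longrightarrow> M (Equ l l)"
    and "eq_replacing S M"
  shows "M F"
proof -
  obtain \<sigma> where "ground_subst (set (alph S)) \<sigma>" using exists_ground_subst[OF assms(3)] by blast
  from R_derivable_sound[OF assms(1,4,5,6) this] assms(2) show ?thesis
    by (simp add: inst_prime_elem)
qed

section \<open>Ground instances of derivable formulas\<close>

fun var_bound_item :: "item \<Rightarrow> nat" where
  "var_bound_item (Con c) = 0"
| "var_bound_item (Var x) = Suc x"
| "var_bound_item (App f l) = sum_list (map var_bound_item l)"

definition var_bound_list :: "item list \<Rightarrow> nat" where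
  "var_bound_list l = sum_list (map var_bound_item l)"

fun var_bound_prime :: "prime_rf \<Rightarrow> nat" where
  "var_bound_prime (Equ l m) = var_bound_list l + var_bound_list m"
| "var_bound_prime (Pred p ls) = sum_list (map var_bound_list ls)"

fun var_bound :: "rformula \<Rightarrow> nat" where
  "var_bound (Prime F) = var_bound_prime F"
| "var_bound (Imp F G) = var_bound_prime F + var_bound G"

lemma inst_item_cong:
  "(\<And>y. y < var_bound_item t \<Longrightarrow> \<sigma> y = \<tau> y) \<Longrightarrow> inst_item \<sigma> t = inst_item \<tau> t"
proof (induction t)
  case (App f l)
  have "inst_item \<sigma> t = inst_item \<tau> t" if "t \<in> set l" for t
    using that member_le_sum_list[of "var_bound_item t" "map var_bound_item l"]
    by (intro App) (auto intro: order.strict_trans2)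
  then have "inst_list \<sigma> l = inst_list \<tau> l"
    by (simp add: inst_list_def cong: map_cong)
  then show ?case by simp
qed auto

lemma inst_list_cong:
  assumes "\<And>y. y < var_bound_list l \<Longrightarrow> \<sigma> y = \<tau> y"
  shows "inst_list \<sigma> l = inst_list \<tau> l"
proof -
  \<comment> \<open>Wrapping \<open>l\<close> into an application reduces lists to items;
    \<open>Box\<close> is an arbitrary choice.\<close>
  have "inst_item \<sigma> (App Box l) = inst_item \<tau> (App Box l)"
    by (rule inst_item_cong) (use assms in \<open>simp add: var_bound_list_def\<close>)
  then show ?thesis by simp
qed

lemma inst_prime_cong:
  assumes "\<And>y. y < var_bound_prime F \<Longrightarrow> \<sigma> y = \<tau> y"
  shows "inst_prime \<sigma> F = inst_prime \<tau> F"
proof (cases F)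
  case (Equ l m)
  then show ?thesis using assms by (auto intro!: inst_list_cong)
next
  case (Pred p ls)
  have "inst_list \<sigma> l = inst_list \<tau> l" if "l \<in> set ls" for l
    using that member_le_sum_list[of "var_bound_list l" "map var_bound_list ls"]
    by (intro inst_list_cong assms) (auto simp: Pred intro: order.strict_trans2)
  then show ?thesis by (simp add: Pred)
qed

lemma inst_rf_cong:
  "(\<And>y. y < var_bound F \<Longrightarrow> \<sigma> y = \<tau> y) \<Longrightarrow> inst_rf \<sigma> F = inst_rf \<tau> F"
  by (induction F) (auto intro!: inst_prime_cong)

lemma inst_Var: "inst_item (\<lambda>y. [Var y]) t = [t]" "inst_list (\<lambda>y. [Var y]) l = l"
proof -
  show *: "inst_item (\<lambda>y. [Var y]) t = [t]" for t
  proof (induction t)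
    case (App f l)
    then have "inst_list (\<lambda>y. [Var y]) l = l" by (induction l) auto
    then show ?case by simp
  qed auto
  show "inst_list (\<lambda>y. [Var y]) l = l" by (induction l) (auto simp: *)
qed

lemma inst_rf_Var: "inst_rf (\<lambda>y. [Var y]) F = F"
proof (induction F)
  case (Prime F) then show ?case by (cases F) (auto simp: inst_Var map_idI)
next
  case (Imp F G) then show ?case by (cases F) (auto simp: inst_Var map_idI)
qed

text \<open>
  Since the substituted lists contain no variables, substituting for
  \<open>x\<^sub>1, x\<^sub>2, \<dots>\<close> one after the other is the same as substituting simultaneously.
\<close>

lemma R_derivable_inst:
  assumes "R_derivable S F" "ground_subst (set (alph S)) \<sigma>"
  shows "R_derivable S (inst_rf \<sigma> F)"
proof -
  have "R_derivable S (inst_rf (\<lambda>y. if y < n then \<sigma> y else [Var y]) F)" for n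
  proof (induction n)
    case 0
    then show ?case using assms(1) by (simp add: inst_rf_Var)
  next
    case (Suc n)
    have "list_over (set (alph S)) (\<sigma> n)"
      using assms(2) by (auto simp: ground_subst_def ground_over_def)
    from substitution[OF Suc this, of n]
    have "R_derivable S (inst_rf (\<lambda>y. inst_list (single n (\<sigma> n)) (if y < n then \<sigma> y else [Var y])) F)"
      by (simp add: subst_rf_inst inst_rf_comp)
    also have "(\<lambda>y. inst_list (single n (\<sigma> n)) (if y < n then \<sigma> y else [Var y]))
      = (\<lambda>y. if y < Suc n then \<sigma> y else [Var y])"
      using assms(2)
      by (auto simp: fun_eq_iff single_def inst_list_elem ground_subst_def ground_over_def less_Suc_eq)
    finally show ?case .
  qed
  \<comment> \<open>Only variables below \<open>var_bound F\<close> occur in \<open>F\<close>, so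
    finitely many single substitutions reach the full instance.\<close>
  moreover have "inst_rf (\<lambda>y. if y < var_bound F then \<sigma> y else [Var y]) F = inst_rf \<sigma> F"
    by (rule inst_rf_cong) simp
  ultimately show ?thesis by metis
qed

section \<open>Derivability as a Horn model\<close>

abbreviation der :: "recsys \<Rightarrow> prime_rf \<Rightarrow> bool" where
  "der S F \<equiv> R_derivable S (Prime F)"

text \<open>With \<open>der_refl\<close> and \<open>eq_replacing_der\<close>, this makes
  derivability itself a model of the kind that \<open>R_derivable_sound\<close> admits. Basis rules
  can then be applied by evaluating \<open>horn\<close> on an instance.\<close>

lemma horn_der: "R_derivable S F \<Longrightarrow> horn (der S) F"
  by (induction F) (auto intro: modus_ponens)

lemma der_rule:
  "G \<in> set (basis S) \<Longrightarrow> ground_subst (set (alph S)) \<sigma> \<Longrightarrow> horn (der S) (inst_rf \<sigma> G)"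
  by (intro horn_der R_derivable_inst basis_axiom)

lemma der_refl:
  assumes "list_over (set (alph S)) l"
  shows "der S (Equ l l)"
  using substitution[OF eq_refl assms, of 0 0] by (simp add: subst_list_inst single_def)

lemma eq_replacing_der: "eq_replacing S (der S)"
  unfolding eq_replacing_def
proof (intro allI impI)
  fix F \<sigma> x y
  assume *: "prime_of S F" "ground_subst (set (alph S)) \<sigma>" "der S (Equ (\<sigma> x) (\<sigma> y))"
    "der S (inst_prime \<sigma> F)"
  have "horn (der S) (inst_rf \<sigma> (Imp (Equ [Var x] [Var y]) (Imp F (Prime (subst_prime x [Var y] F)))))"
    by (intro horn_der R_derivable_inst eq_repl *)
  with * show "der S (inst_prime (\<sigma>(x := \<sigma> y)) F)"
    by (simp add: subst_prime_inst inst_prime_comp inst_list_single)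
qed

lemma list_over_mono: "list_over A l \<Longrightarrow> A \<subseteq> B \<Longrightarrow> list_over B l"
proof -
  assume "list_over A l" "A \<subseteq> B"
  have "item_over A t \<Longrightarrow> item_over B t" for t
    using \<open>A \<subseteq> B\<close> by (induction t) auto
  then show ?thesis using \<open>list_over A l\<close> by (auto simp: list_over_def)
qed

text \<open>Substitution admits only lists over the alphabet, so derivations never leave the system.
  The alphabet of a representing system can thus be bounded from below by an element of the set it
  represents.\<close>

lemma R_derivable_rformula_of:
  assumes "recursive_system S" "R_derivable S F"
  shows "rformula_of S F"
proof -
  let ?A = "set (alph S)"
  have pr: "prime_of S (subst_prime x m F)" if "prime_of S F" "list_over ?A m" for x m F
  proof -
    have "list_over ?A (single x m y)" for y using that(2) by (simp add: single_def list_over_def)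
    then show ?thesis
      using that(1) by (cases F) (auto simp: subst_prime_inst intro!: list_over_inst_list)
  qed
  have rf: "rformula_of S (subst_rf x m F)" if "rformula_of S F" "list_over ?A m" for x m F
    using that by (induction F) (auto simp: pr)
  show ?thesis
    using assms(2)
  proof induction
    case (basis_axiom F)
    then show ?case using assms(1) by (simp add: recursive_system_def)
  qed (auto simp: pr rf list_over_def)
qed

section \<open>Eliminating the built-in equality\<close>

fun map_rf :: "(prime_rf \<Rightarrow> prime_rf) \<Rightarrow> rformula \<Rightarrow> rformula" where
  "map_rf f (Prime F) = Prime (f F)"
| "map_rf f (Imp F G) = Imp (f F) (map_rf f G)"

fun elim_eq :: "nat \<Rightarrow> prime_rf \<Rightarrow> prime_rf" where
  "elim_eq e (Equ l m) = Pred e [l, m]"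
| "elim_eq e (Pred p ls) = Pred p ls"

fun arity_prime :: "prime_rf \<Rightarrow> nat" where
  "arity_prime (Equ l m) = 2"
| "arity_prime (Pred p ls) = length ls"

fun arity_sum :: "rformula \<Rightarrow> nat" where
  "arity_sum (Prime F) = arity_prime F"
| "arity_sum (Imp F G) = arity_prime F + arity_sum G"

text \<open>The successor of the sum lies strictly above every arity in the basis, which fits
  half-open ranges of arities.\<close>

definition arity_bound :: "recsys \<Rightarrow> nat" where
  "arity_bound S = Suc (sum_list (map arity_sum (basis S)))"

definition fresh_pred :: "recsys \<Rightarrow> nat" where
  "fresh_pred S = Suc (sum_list (prds S))"

text \<open>Only a whole argument is exchanged; replacement inside an argument is left to the
  congruence axioms. Variables 0 and 1 are the equated ones, hence the shift by 2 for the other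
  arguments.\<close>

definition repl_axiom :: "nat \<Rightarrow> nat \<Rightarrow> nat \<Rightarrow> nat \<Rightarrow> rformula" where
  "repl_axiom e r n i = Imp (Pred e [[Var 0], [Var 1]])
     (Imp (Pred r ((map (\<lambda>j. [Var (j + 2)]) [0..<n])[i := [Var 0]]))
       (Prime (Pred r ((map (\<lambda>j. [Var (j + 2)]) [0..<n])[i := [Var 1]]))))"

definition app_axiom :: "nat \<Rightarrow> csym \<Rightarrow> rformula" where
  "app_axiom e f = Imp (Pred e [[Var 0], [Var 1]]) (Prime (Pred e [[App f [Var 0]], [App f [Var 1]]]))"

text \<open>The second axiom is the Euclidean law, which together with reflexivity yields symmetry
  and transitivity. Congruence of concatenation is given on one side at a time; transitivity
  combines the two.\<close>

definition eq_axioms :: "recsys \<Rightarrow> nat \<Rightarrow> rformula list" where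
  "eq_axioms S e =
    [Prime (Pred e [[Var 0], [Var 0]]),
     Imp (Pred e [[Var 0], [Var 1]]) (Imp (Pred e [[Var 0], [Var 2]]) (Prime (Pred e [[Var 1], [Var 2]]))),
     Imp (Pred e [[Var 0], [Var 1]]) (Prime (Pred e [[Var 0, Var 2], [Var 1, Var 2]])),
     Imp (Pred e [[Var 0], [Var 1]]) (Prime (Pred e [[Var 2, Var 0], [Var 2, Var 1]]))]
    @ map (app_axiom e) (alph S)
    @ concat (map (\<lambda>r. concat (map (\<lambda>n. map (repl_axiom e r n) [0..<n]) [0..<arity_bound S])) (prds S))"

text \<open>
  Equality of \<open>S\<close>, simulated by \<open>fresh_pred S\<close>, does not act on the \<open>n\<close> new predicates
  of the rules \<open>X\<close>. As predicates have no fixed arity, replacement axioms are only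
  given for the arities that occur in \<open>basis S\<close>.
\<close>

definition eq_free_ext :: "recsys \<Rightarrow> nat \<Rightarrow> rformula list \<Rightarrow> recsys" where
  "eq_free_ext S n X =
     \<lparr>alph = alph S, prds = prds S @ [fresh_pred S..<fresh_pred S + Suc n],
      basis = map (map_rf (elim_eq (fresh_pred S))) (basis S) @ eq_axioms S (fresh_pred S) @ X\<rparr>"

lemma alph_eq_free_ext [simp]: "alph (eq_free_ext S n X) = alph S"
  by (simp add: eq_free_ext_def)

lemma prds_eq_free_ext:
  "prds (eq_free_ext S n X) = prds S @ [fresh_pred S..<fresh_pred S + Suc n]"
  by (simp add: eq_free_ext_def)

lemma fresh_pred_notin: "p \<in> set (prds S) \<Longrightarrow> p < fresh_pred S"
  unfolding fresh_pred_def using member_le_sum_list[of p "prds S"] by simp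

lemma recursive_system_eq_free_ext:
  assumes S: "recursive_system S" and X: "\<And>G. G \<in> set X \<Longrightarrow> rformula_of (eq_free_ext S n X) G"
  shows "recursive_system (eq_free_ext S n X)"
proof -
  let ?U = "eq_free_ext S n X"
  have e: "fresh_pred S \<in> set (prds ?U)" by (simp add: prds_eq_free_ext del: upt_Suc)
  have "rformula_of ?U (map_rf (elim_eq (fresh_pred S)) G)" if "rformula_of S G" for G
  proof -
    have "prime_of ?U (elim_eq (fresh_pred S) F)" if "prime_of S F" for F
      using that e by (cases F) (auto simp: prds_eq_free_ext)
    then show ?thesis using that by (induction G) auto
  qed
  moreover have "rformula_of ?U G" if "G \<in> set (eq_axioms S (fresh_pred S))" for G
  proof -
    have "\<forall>l\<in>set ((map (\<lambda>j. [Var (j + 2)]) [0..<n])[i := [Var k]]). list_over (set (alph S)) l" for n i k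
      by (auto simp: list_over_def dest!: subsetD[OF set_update_subset_insert])
    then show ?thesis
      using that e by (auto simp: eq_axioms_def app_axiom_def repl_axiom_def list_over_def prds_eq_free_ext)
  qed
  moreover have "set (prds S) \<inter> {fresh_pred S..<fresh_pred S + Suc n} = {}"
    using fresh_pred_notin[of _ S] by fastforce
  then have "distinct (prds ?U)"
    using S by (simp add: prds_eq_free_ext recursive_system_def del: upt_Suc)
  ultimately show ?thesis
    using S X unfolding recursive_system_def by (auto simp: eq_free_ext_def[of S n X])
qed

text \<open>Reading the built-in equality as identity makes replacement hold for any
  \<open>K\<close>, so new predicates need not respect the equations of \<open>S\<close>; these
  survive only in the predicate \<open>fresh_pred S\<close>.\<close>

definition ext_model :: "recsys \<Rightarrow> (nat \<Rightarrow> item list list \<Rightarrow> bool) \<Rightarrow> prime_rf \<Rightarrow> bool" where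
  "ext_model S K F = (case F of Equ l m \<Rightarrow> l = m
     | Pred r ls \<Rightarrow> if r = fresh_pred S then \<exists>l m. ls = [l, m] \<and> der S (Equ l m)
         else if r \<in> set (prds S) then der S (Pred r ls) else K r ls)"

lemma eq_replacingD:
  "eq_replacing S M \<Longrightarrow> prime_of S F \<Longrightarrow> ground_subst (set (alph S)) \<sigma> \<Longrightarrow>
   M (Equ (\<sigma> x) (\<sigma> y)) \<Longrightarrow> M (inst_prime \<sigma> F) \<Longrightarrow> M (inst_prime (\<sigma>(x := \<sigma> y)) F)"
  unfolding eq_replacing_def by blast

lemma list_over_Var [simp]: "list_over A [Var x]"
  by (simp add: list_over_def)

lemma eq_axioms_valid:
  assumes "G \<in> set (eq_axioms S (fresh_pred S))" and \<sigma>: "ground_subst (set (alph S)) \<sigma>"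
  shows "horn (ext_model S K) (inst_rf \<sigma> G)"
proof -
  \<comment> \<open>Variable 3 holds a second copy of \<open>\<sigma> 0\<close> that stays untouched
    when variable 0 is replaced by variable 1. A reflexive equation thus turns into the desired
    congruence.\<close>
  let ?A = "set (alph S)" and ?\<tau> = "\<sigma>(3 := \<sigma> 0)"
  have \<tau>: "ground_subst ?A ?\<tau>"
    using \<sigma> by (auto simp: ground_subst_def)
  have g: "list_over ?A (\<sigma> x)" for x
    using \<sigma> by (auto simp: ground_subst_def ground_over_def)
  have gg: "list_over ?A (\<sigma> x @ \<sigma> y)" for x y
    using g[of x] g[of y] by (auto simp: list_over_def)
  have euclid: "der S (Equ (\<sigma> 1) (\<sigma> 2))" if "der S (Equ (\<sigma> 0) (\<sigma> 1))" "der S (Equ (\<sigma> 0) (\<sigma> 2))"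
    using eq_replacingD[OF eq_replacing_der, of S "Equ [Var 0] [Var 2]" \<sigma> 0 1] that \<sigma> by simp
  have left: "der S (Equ (\<sigma> 0 @ \<sigma> 2) (\<sigma> 1 @ \<sigma> 2))" if "der S (Equ (\<sigma> 0) (\<sigma> 1))"
    using eq_replacingD[OF eq_replacing_der, of S "Equ [Var 3, Var 2] [Var 0, Var 2]" ?\<tau> 0 1] that \<tau>
      der_refl[OF gg] by (simp add: list_over_def)
  have right: "der S (Equ (\<sigma> 2 @ \<sigma> 0) (\<sigma> 2 @ \<sigma> 1))" if "der S (Equ (\<sigma> 0) (\<sigma> 1))"
    using eq_replacingD[OF eq_replacing_der, of S "Equ [Var 2, Var 3] [Var 2, Var 0]" ?\<tau> 0 1] that \<tau>
      der_refl[OF gg] by (simp add: list_over_def)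
  have app: "der S (Equ [App f (\<sigma> 0)] [App f (\<sigma> 1)])"
    if "der S (Equ (\<sigma> 0) (\<sigma> 1))" "f \<in> ?A" for f
  proof -
    have "list_over ?A [App f (\<sigma> 0)]" using g[of 0] that(2) by (auto simp: list_over_def)
    then show ?thesis
      using eq_replacingD[OF eq_replacing_der, of S "Equ [App f [Var 3]] [App f [Var 0]]" ?\<tau> 0 1] that \<tau>
        der_refl[OF \<open>list_over ?A [App f (\<sigma> 0)]\<close>] by (simp add: list_over_def)
  qed
  have repl: "der S (Pred r (map (inst_list \<sigma>) ((map (\<lambda>j. [Var (j + 2)]) [0..<n])[i := [Var 1]])))"
    if "der S (Equ (\<sigma> 0) (\<sigma> 1))" "r \<in> set (prds S)" "i < n"
      "der S (Pred r (map (inst_list \<sigma>) ((map (\<lambda>j. [Var (j + 2)]) [0..<n])[i := [Var 0]])))" for r n i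
  proof -
    let ?ls = "(map (\<lambda>j. [Var (j + 2)]) [0..<n])[i := [Var 0]]"
    have "\<forall>l\<in>set ?ls. list_over ?A l"
      by (auto simp: list_over_def dest!: subsetD[OF set_update_subset_insert])
    then have "der S (inst_prime (\<sigma>(0 := \<sigma> 1)) (Pred r ?ls))"
      by (intro eq_replacingD[OF eq_replacing_der] \<sigma>) (use that in auto)
    moreover have "map (inst_list (\<sigma>(0 := \<sigma> 1))) ?ls
        = map (inst_list \<sigma>) ((map (\<lambda>j. [Var (j + 2)]) [0..<n])[i := [Var 1]])"
      using that(3) by (intro nth_equalityI) (auto simp: nth_list_update)
    ultimately show ?thesis by simp
  qed
  have "r \<noteq> fresh_pred S" if "r \<in> set (prds S)" for r
    using fresh_pred_notin[OF that] by simp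
  then show ?thesis
    using assms(1) euclid left right app repl
    by (auto simp: eq_axioms_def ext_model_def app_axiom_def repl_axiom_def der_refl g)
qed

text \<open>A rewritten axiom of \<open>S\<close> is true in \<open>ext_model\<close> because the
  original is derivable in \<open>S\<close>. Hence rules that are valid for \<open>K\<close> add no
  facts about the old predicates.\<close>

theorem eq_free_ext_sound:
  assumes S: "recursive_system S" "alph S \<noteq> []"
    and X: "\<And>G \<sigma>. G \<in> set X \<Longrightarrow> ground_subst (set (alph S)) \<sigma> \<Longrightarrow> horn (ext_model S K) (inst_rf \<sigma> G)"
    and F: "der (eq_free_ext S n X) F" "elem_prime F"
  shows "ext_model S K F"
proof (rule R_derivable_sound_elem[OF F])
  fix G \<sigma>
  assume G: "G \<in> set (basis (eq_free_ext S n X))"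
    and "ground_subst (set (alph (eq_free_ext S n X))) \<sigma>"
  then have \<sigma>: "ground_subst (set (alph S)) \<sigma>" by simp
  have "horn (ext_model S K) (inst_rf \<sigma> (map_rf (elim_eq (fresh_pred S)) H))" if "H \<in> set (basis S)" for H
  proof -
    have "ext_model S K (inst_prime \<sigma> (elim_eq (fresh_pred S) F)) \<longleftrightarrow> der S (inst_prime \<sigma> F)"
      if "prime_of S F" for F
      using that fresh_pred_notin[of _ S] by (cases F) (auto simp: ext_model_def)
    then have "horn (ext_model S K) (inst_rf \<sigma> (map_rf (elim_eq (fresh_pred S)) H))
        \<longleftrightarrow> horn (der S) (inst_rf \<sigma> H)" if "rformula_of S H"
      using that by (induction H) auto
    then show ?thesis using S(1) that der_rule[OF that \<sigma>] by (auto simp: recursive_system_def)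
  qed
  then show "horn (ext_model S K) (inst_rf \<sigma> G)"
    using G eq_axioms_valid[OF _ \<sigma>] X[OF _ \<sigma>] by (auto simp: eq_free_ext_def)
next
  \<comment> \<open>If \<open>\<sigma> x\<close> and \<open>\<sigma> y\<close> are identical, the
    update changes nothing.\<close>
  show "eq_replacing (eq_free_ext S n X) (ext_model S K)"
    by (auto simp: eq_replacing_def ext_model_def) (metis fun_upd_triv)+
qed (use S in \<open>auto simp: ext_model_def\<close>)

text \<open>Derivations are not translated step by step: the extension itself furnishes a model of
  \<open>S\<close> in which equality means the predicate \<open>fresh_pred S\<close>, and soundness
  of \<open>S\<close> in this model gives the claim.\<close>

theorem eq_free_ext_complete:
  assumes S: "recursive_system S" "alph S \<noteq> []"
    and F: "der S (Pred p ls)" "\<And>l. l \<in> set ls \<Longrightarrow> elem_list l"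
  shows "der (eq_free_ext S n X) (Pred p ls)"
proof -
  let ?U = "eq_free_ext S n X" and ?A = "set (alph S)" and ?e = "fresh_pred S"
  define E where "E l m = der ?U (Pred ?e [l, m])" for l m
  let ?N = "arity_bound S"
  \<comment> \<open>Replacement axioms exist only for arities below \<open>?N\<close>, so atoms of
    larger arity are declared false. No basis axiom mentions such an atom, so the axioms of
    \<open>S\<close> remain true.\<close>
  let ?M = "case_prime_rf E (\<lambda>r ls. length ls < ?N \<and> der ?U (Pred r ls))"
  have rule: "horn (der ?U) (inst_rf \<sigma> G)"
    if "G \<in> set (eq_axioms S ?e)" "ground_subst ?A \<sigma>" for G \<sigma>
    by (rule der_rule) (use that in \<open>auto simp: eq_free_ext_def\<close>)
  define asg :: "item list \<Rightarrow> item list \<Rightarrow> item list \<Rightarrow> nat \<Rightarrow> item list" where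
    "asg x y z = (\<lambda>i. if i = 0 then x else if i = 1 then y else z)" for x y z
  have asg: "ground_subst ?A (asg x y z)" if "ground_over ?A x" "ground_over ?A y" "ground_over ?A z" for x y z
    using that by (simp add: ground_subst_def asg_def)
  have refl: "E x x" if "ground_over ?A x" for x
    using rule[of "Prime (Pred ?e [[Var 0], [Var 0]])", OF _ asg[OF that that that]]
    by (simp add: eq_axioms_def E_def asg_def)
  have euclid: "E y z" if "E x y" "E x z" "ground_over ?A x" "ground_over ?A y" "ground_over ?A z" for x y z
    using rule[of "eq_axioms S ?e ! 1", OF _ asg[OF that(3-5)]] that(1,2)
    by (simp add: eq_axioms_def E_def asg_def)
  have left: "E (x @ z) (y @ z)" if "E x y" "ground_over ?A x" "ground_over ?A y" "ground_over ?A z" for x y z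
    using rule[of "eq_axioms S ?e ! 2", OF _ asg[OF that(2-4)]] that(1)
    by (simp add: eq_axioms_def E_def asg_def)
  have right: "E (z @ x) (z @ y)" if "E x y" "ground_over ?A x" "ground_over ?A y" "ground_over ?A z" for x y z
    using rule[of "eq_axioms S ?e ! 3", OF _ asg[OF that(2-4)]] that(1)
    by (simp add: eq_axioms_def E_def asg_def)
  have app: "E [App f x] [App f y]" if "E x y" "ground_over ?A x" "ground_over ?A y" "f \<in> ?A" for f x y
    using rule[of "app_axiom ?e f", OF _ asg[OF that(2,3,3)]] that(1,4)
    by (simp add: eq_axioms_def E_def asg_def app_axiom_def)
  have sym: "E y x" if "E x y" "ground_over ?A x" "ground_over ?A y" for x y
    using euclid[OF that(1) refl that(2,3,2)] that by blast
  have trans: "E x z" if "E x y" "E y z" "ground_over ?A x" "ground_over ?A y" "ground_over ?A z" for x y z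
    using euclid[OF sym[OF that(1)] that(2)] that by blast
  have append: "E (x @ z) (y @ w)"
    if "E x y" "E z w" "ground_over ?A x" "ground_over ?A y" "ground_over ?A z" "ground_over ?A w" for x y z w
    using trans[OF left[OF that(1,3-5)] right[OF that(2,5,6,4)]] that by (auto intro: ground_over_append)
  have repl: "der ?U (Pred r (us[i := y]))"
    if r: "r \<in> set (prds S)" "length us < ?N" "i < length us" "E (us ! i) y" "der ?U (Pred r us)"
      and us: "\<forall>u\<in>set us. ground_over ?A u" "ground_over ?A y" for r us i y
  proof -
    \<comment> \<open>Variables 0 and 1 carry the old and the new argument, variable
      \<open>j + 2\<close> the argument at \<open>j\<close>; beyond these, \<open>y\<close> only
      keeps the substitution ground.\<close>
    define \<sigma> where "\<sigma> j = (if j = 0 then us ! i else if j = 1 then y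
        else if j - 2 < length us then us ! (j - 2) else y)" for j
    have "ground_subst ?A \<sigma>" using us r(3) by (auto simp: ground_subst_def \<sigma>_def)
    moreover have "repl_axiom ?e r (length us) i \<in> set (eq_axioms S ?e)"
    proof -
      have "\<exists>r\<in>set (prds S). \<exists>n\<in>{0..<?N}. repl_axiom ?e r' (length us) i \<in> repl_axiom ?e r n ` {0..<n}"
        if "r' = r" for r'
        unfolding that using r by (intro bexI[of _ r] bexI[of _ "length us"]) auto
      then show ?thesis by (simp add: eq_axioms_def)
    qed
    ultimately have "horn (der ?U) (inst_rf \<sigma> (repl_axiom ?e r (length us) i))" using rule by blast
    moreover have "map (inst_list \<sigma>) ((map (\<lambda>j. [Var (j + 2)]) [0..<length us])[i := [Var 0]]) = us"
      using r(3) by (intro nth_equalityI) (auto simp: nth_list_update \<sigma>_def)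
    moreover have "map (inst_list \<sigma>) ((map (\<lambda>j. [Var (j + 2)]) [0..<length us])[i := [Var 1]]) = us[i := y]"
      using r(3) by (intro nth_equalityI) (auto simp: nth_list_update \<sigma>_def)
    ultimately show ?thesis using r(4,5) by (simp add: repl_axiom_def E_def \<sigma>_def)
  qed
  have replaces: "?M (inst_prime (\<sigma>(x := \<sigma> y)) F)"
    if F: "prime_of S F" and \<sigma>: "ground_subst ?A \<sigma>" and xy: "E (\<sigma> x) (\<sigma> y)" and MF: "?M (inst_prime \<sigma> F)" for F \<sigma> x y
  proof -
    let ?\<tau> = "\<sigma>(x := \<sigma> y)"
    have \<tau>: "ground_subst ?A ?\<tau>" using \<sigma> by (auto simp: ground_subst_def)
    have gi: "ground_over ?A (inst_item \<sigma> t)" "ground_over ?A (inst_item ?\<tau> t)" if "item_over ?A t" for t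
      using that \<sigma> \<tau> by (auto intro: ground_inst_item)
    have gl: "ground_over ?A (inst_list \<sigma> l)" "ground_over ?A (inst_list ?\<tau> l)" if "list_over ?A l" for l
      using that \<sigma> \<tau> by (auto intro: ground_inst_list)
    \<comment> \<open>Conditional on the items, so that the induction over items can invoke it for
      the argument of an application.\<close>
    have congl: "E (inst_list \<sigma> l) (inst_list ?\<tau> l)"
      if "l \<noteq> []" "\<And>t. t \<in> set l \<Longrightarrow> item_over ?A t \<and> E (inst_item \<sigma> t) (inst_item ?\<tau> t)" for l
      using that
    proof (induction l)
      case (Cons t l)
      show ?case
      proof (cases "l = []")
        case False
        then have "list_over ?A l" using Cons.prems by (auto simp: list_over_def)
        then show ?thesis
          using Cons False by (auto intro!: append gi gl simp del: fun_upd_apply)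
      qed (use Cons.prems in simp)
    qed simp
    have cong: "E (inst_item \<sigma> t) (inst_item ?\<tau> t)" if "item_over ?A t" for t
      using that
    proof (induction t)
      case (Con c)
      then show ?case using gi[OF Con] by (auto intro: refl)
    next
      case (Var z)
      then show ?case using xy \<sigma> by (auto simp: ground_subst_def intro: refl)
    next
      case (App f l)
      then have "list_over ?A l" by (simp add: list_over_def)
      with App show ?case by (auto intro!: app congl gl simp del: fun_upd_apply)
    qed
    have congl: "E (inst_list \<sigma> l) (inst_list ?\<tau> l)" if "list_over ?A l" for l
      by (rule congl) (use that cong in \<open>auto simp: list_over_def\<close>)
    show ?thesis
    proof (cases F)
      case (Equ l k)
      with F have lk: "list_over ?A l" "list_over ?A k" by auto
      have "E (inst_list \<sigma> l) (inst_list \<sigma> k)" using MF Equ by simp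
      then have "E (inst_list ?\<tau> l) (inst_list \<sigma> k)"
        using trans[OF sym[OF congl[OF lk(1)]]] gl lk by blast
      then have "E (inst_list ?\<tau> l) (inst_list ?\<tau> k)"
        using trans[OF _ congl[OF lk(2)]] gl lk by blast
      then show ?thesis using Equ by simp
    next
      case (Pred r ls)
      with F have r: "r \<in> set (prds S)" and ls: "\<And>l. l \<in> set ls \<Longrightarrow> list_over ?A l" by auto
      let ?us = "map (inst_list \<sigma>) ls" and ?vs = "map (inst_list ?\<tau>) ls"
      from MF Pred have len: "length ls < ?N" and us: "der ?U (Pred r ?us)" by auto
      \<comment> \<open>An axiom exchanges a single argument, so the arguments are exchanged one by
        one from left to right.\<close>
      have "i \<le> length ls \<Longrightarrow> der ?U (Pred r (take i ?vs @ drop i ?us))" for i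
      proof (induction i)
        case 0
        show ?case using us by simp
      next
        case (Suc i)
        let ?ws = "take i ?vs @ drop i ?us"
        have i: "i < length ls" "ls ! i \<in> set ls" using Suc by auto
        have ws: "\<forall>u\<in>set ?ws. ground_over ?A u"
          using gl ls by (fastforce dest!: in_set_takeD in_set_dropD simp del: fun_upd_apply)
        have "der ?U (Pred r (?ws[i := ?vs ! i]))"
          by (rule repl)
             (use Suc i len r ls ws gl congl in \<open>auto simp: nth_append simp del: fun_upd_apply\<close>)
        moreover have "?ws[i := ?vs ! i] = take (Suc i) ?vs @ drop (Suc i) ?us"
          using i by (intro nth_equalityI) (auto simp: nth_append nth_list_update less_Suc_eq)
        ultimately show ?case by metis
      qed
      from this[of "length ls"] show ?thesis using len Pred by simp
    qed
  qed
  have "?M (Pred p ls)"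
  proof (rule R_derivable_sound_elem[OF F(1)])
    fix G \<sigma>
    assume G: "G \<in> set (basis S)" and \<sigma>: "ground_subst ?A \<sigma>"
    have "horn (der ?U) (inst_rf \<sigma> (map_rf (elim_eq ?e) G))"
      by (rule der_rule) (use G \<sigma> in \<open>auto simp: eq_free_ext_def\<close>)
    moreover have "arity_sum G < ?N"
      using member_le_sum_list[of "arity_sum G" "map arity_sum (basis S)"] G by (simp add: arity_bound_def)
    moreover have M: "?M (inst_prime \<sigma> F) \<longleftrightarrow> der ?U (inst_prime \<sigma> (elim_eq ?e F))"
      if "arity_prime F < ?N" for F
      using that by (cases F) (auto simp: E_def)
    ultimately show "horn ?M (inst_rf \<sigma> G)"
      by (induction G) (auto simp: M)
  next
    show "eq_replacing S ?M"
      unfolding eq_replacing_def using replaces by (simp del: fun_upd_apply)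
  qed (use S F refl in auto)
  then show ?thesis by simp
qed

section \<open>Codes\<close>

lemma set_A11: "set A11 = {Sym_a, Sym_v, Sym_p, Box, Accent, Star, U_Sim, U_LPar, U_RPar, U_Comma, U_Arrow}"
  by (simp add: A11_def)

lemma set_accents: "set (accents n) \<subseteq> {Accent}"
  by (auto simp: accents_def)

lemma accents_Suc: "accents (Suc n) = Accent # accents n" "accents (Suc n) = accents n @ [Accent]"
  by (simp_all add: accents_def replicate_append_same)

text \<open>Indices are written as maximal runs of accents; the guards prevent a remainder from
  prolonging its run.\<close>

lemma accents_append_eqD:
  assumes "accents m @ r = accents n @ s"
    and "r = [] \<or> hd r \<noteq> Accent" "s = [] \<or> hd s \<noteq> Accent"
  shows "m = n \<and> r = s"
  using assms
proof (induction m arbitrary: n)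
  case 0
  then show ?case by (cases n) (auto simp: accents_def)
next
  case (Suc m)
  then show ?case by (cases n) (auto simp: accents_def)
qed

lemma accents_inj: "accents m = accents n \<Longrightarrow> m = n"
  using accents_append_eqD[of m "[]" n "[]"] by simp

lemma posn_inj: "a \<in> set xs \<Longrightarrow> b \<in> set xs \<Longrightarrow> posn xs a = posn xs b \<Longrightarrow> a = b"
  by (induction xs) (auto simp: posn_def split: if_splits)

lemma posn_le: "a \<in> set xs \<Longrightarrow> posn xs a \<le> length xs"
  by (induction xs) (auto simp: posn_def)

lemma posn_nth: "distinct xs \<Longrightarrow> i < length xs \<Longrightarrow> posn xs (xs ! i) = Suc i"
proof (induction xs arbitrary: i)
  case (Cons x xs)
  then show ?case by (cases i) (auto simp: posn_def)
qed simp

lemma posn_pos: "\<exists>i. posn xs a = Suc i" by (simp add: posn_def)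

lemma code_list_simps [simp]:
  "code_list S [] = []"
  "code_list S (t # l) = code_item S t @ code_list S l"
  "code_list S (l @ m) = code_list S l @ code_list S m"
  by (simp_all add: code_list_def)

lemma code_item_App [simp]:
  "code_item S (App f l) = Sym_a # accents (posn (alph S) f) @ [U_LPar] @ code_list S l @ [U_RPar]"
  by (simp add: code_list_def)

declare code_item.simps(3) [simp del]

lemma set_code_item: "set (code_item S t) \<subseteq> {Sym_a, Sym_v, Accent, U_LPar, U_RPar}"
proof (induction t)
  case (App f l)
  then have "set (code_list S l) \<subseteq> {Sym_a, Sym_v, Accent, U_LPar, U_RPar}"
    unfolding code_list_def by auto
  then show ?case using set_accents[of "posn (alph S) f"] by auto
qed (use set_accents in auto)

lemma set_code_list: "set (code_list S l) \<subseteq> {Sym_a, Sym_v, Accent, U_LPar, U_RPar}"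
  using set_code_item unfolding code_list_def by auto

lemma code_args_Cons: "code_args S (l # ls) = code_list S l @ (if ls = [] then [] else U_Comma # code_args S ls)"
  by (cases ls) auto

lemma set_code_args: "set (code_args S ls) \<subseteq> {Sym_a, Sym_v, Accent, U_LPar, U_RPar, U_Comma}"
proof (induction ls)
  case (Cons l ls)
  then show ?case using set_code_list[of S l] unfolding code_args_Cons by auto
qed simp

lemma set_code_prime:
  "set (code_prime S F) \<subseteq> {Sym_a, Sym_v, Accent, U_LPar, U_RPar, U_Comma, U_Sim, Sym_p}"
proof (cases F)
  case (Equ l m)
  then show ?thesis using set_code_args[of S "[l, m]"] by auto
next
  case (Pred p ls)
  then show ?thesis using set_code_args[of S ls] set_accents[of "posn (prds S) p"] by auto
qed

lemma set_code_rf: "set (code_rf S F) \<subseteq> set A11 - {Star, Box}"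
  by (induction F) (use set_code_prime in \<open>auto simp: set_A11\<close>)

lemma tally_no_Star: "Star \<notin> set (tally n)" and set_tally: "set (tally n) \<subseteq> {Box, Accent}"
  by (auto simp: tally_def accents_def)

lemma tally_inj: "tally m = tally n \<Longrightarrow> m = n"
  by (cases m; cases n) (auto simp: tally_def accents_Suc(1) dest: accents_inj)

lemma append_delimiter_eqD:
  "xs @ d # ys = xs' @ d # ys' \<Longrightarrow> d \<notin> set xs \<Longrightarrow> d \<notin> set xs' \<Longrightarrow> xs = xs' \<and> ys = ys'"
proof (induction xs arbitrary: xs')
  case Nil then show ?case by (cases xs') auto
next
  case (Cons x xs) then show ?case by (cases xs') auto
qed

lemma append_delimiter_eqD':
  assumes "xs @ d # ys = xs' @ d # ys'" "d \<notin> set ys" "d \<notin> set ys'"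
  shows "xs = xs' \<and> ys = ys'"
  using append_delimiter_eqD[of "rev ys" d "rev xs" "rev ys'" "rev xs'"] arg_cong[OF assms(1), of rev] assms(2,3)
  by simp

definition code_basis :: "recsys \<Rightarrow> rformula list \<Rightarrow> csym list" where
  "code_basis S B = (if B = [] then [Box, Star] else concat (map (\<lambda>F. code_rf S F @ [Star]) B))"

lemma basis_string_eq:
  "basis_string S = tally (length (alph S)) @ Star # tally (length (prds S)) @ Star # code_basis S (basis S)"
  by (simp add: basis_string_def code_basis_def)

lemma code_basis_snoc: "\<exists>w. code_basis S B = w @ [Star] \<and> set w \<subseteq> set A11"
proof (cases B rule: rev_cases)
  case (snoc B' F)
  moreover have "set (concat (map (\<lambda>F. code_rf S F @ [Star]) B')) \<subseteq> set A11"
    using set_code_rf[of S] by (auto simp: set_A11 subset_iff)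
  ultimately show ?thesis using set_code_rf[of S F]
    by (intro exI[of _ "concat (map (\<lambda>F. code_rf S F @ [Star]) B') @ code_rf S F"])
      (auto simp: code_basis_def)
qed (auto simp: code_basis_def set_A11)

lemma basis_string_snoc: "\<exists>w. basis_string S = w @ [Star] \<and> w \<noteq> [] \<and> set w \<subseteq> set A11"
proof -
  obtain w where "code_basis S (basis S) = w @ [Star]" "set w \<subseteq> set A11"
    using code_basis_snoc by blast
  then show ?thesis
    using set_tally[of "length (alph S)"] set_tally[of "length (prds S)"]
    by (intro exI[of _ "tally (length (alph S)) @ Star # tally (length (prds S)) @ Star # w"])
      (auto simp: basis_string_eq set_A11)
qed

lemma set_basis_string: "set (basis_string S) \<subseteq> set A11"
  using basis_string_snoc[of S] by (auto simp: set_A11)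

text \<open>A basis string ends in a star while the code of a prime formula has none, so the last
  star of a statement marks the boundary.\<close>

lemma split_statement:
  assumes "basis_string S @ x = basis_string T @ y" "Star \<notin> set x" "Star \<notin> set y"
  shows "basis_string S = basis_string T \<and> x = y"
proof -
  obtain v w where "basis_string S = v @ [Star]" "basis_string T = w @ [Star]"
    using basis_string_snoc by metis
  with assms show ?thesis using append_delimiter_eqD'[of v Star x w y] by simp
qed

lemma code_prime_no_Star: "Star \<notin> set (code_prime S F)"
  using set_code_prime by fastforce

text \<open>Stars separate the axioms and occur in no axiom code. The marker of an empty basis is
  unambiguous because no axiom code contains \<open>Box\<close>.\<close>

lemma code_basis_inj:
  assumes "code_basis S B = code_basis T C"
  shows "map (code_rf S) B = map (code_rf T) C"
proof -
  have split: "concat (map (\<lambda>F. code_rf S F @ [Star]) B) = concat (map (\<lambda>F. code_rf T F @ [Star]) C) \<Longrightarrow>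
      map (code_rf S) B = map (code_rf T) C" for B C
  proof (induction B arbitrary: C)
    case Nil
    then show ?case by (cases C) auto
  next
    case (Cons F B)
    then obtain G C' where C: "C = G # C'" by (cases C) auto
    have "Star \<notin> set (code_rf S F)" "Star \<notin> set (code_rf T G)"
      using set_code_rf by fastforce+
    moreover have "code_rf S F @ Star # concat (map (\<lambda>F. code_rf S F @ [Star]) B) =
        code_rf T G @ Star # concat (map (\<lambda>F. code_rf T F @ [Star]) C')"
      using Cons.prems C by simp
    ultimately have "code_rf S F = code_rf T G \<and>
        concat (map (\<lambda>F. code_rf S F @ [Star]) B) = concat (map (\<lambda>F. code_rf T F @ [Star]) C')"
      by (intro append_delimiter_eqD)
    with Cons.IH C show ?case by simp
  qed
  have "concat (map (\<lambda>F. code_rf S F @ [Star]) B) \<noteq> [Box, Star]" for S B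
  proof
    assume *: "concat (map (\<lambda>F. code_rf S F @ [Star]) B) = [Box, Star]"
    then obtain F B' where "B = F # B'" by (cases B) auto
    with * show False using set_code_rf[of S F] by (cases "code_rf S F") auto
  qed
  then show ?thesis using assms split[of B C]
    by (auto simp: code_basis_def split: if_splits)
qed

lemma basis_string_inj:
  assumes "basis_string S = basis_string T"
  shows "length (alph S) = length (alph T)" "length (prds S) = length (prds T)"
    "map (code_rf S) (basis S) = map (code_rf T) (basis T)"
proof -
  note 1 = append_delimiter_eqD[OF assms[unfolded basis_string_eq] tally_no_Star tally_no_Star]
  note 2 = append_delimiter_eqD[OF conjunct2[OF 1] tally_no_Star tally_no_Star]
  from 1 2 show "length (alph S) = length (alph T)" "length (prds S) = length (prds T)"
    "map (code_rf S) (basis S) = map (code_rf T) (basis T)"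
    by (auto dest: tally_inj code_basis_inj)
qed

subsection \<open>Unique decoding\<close>

text \<open>Remainders must not prolong what precedes them: an accent would extend an index, a
  parenthesis would turn a constant into an application, and after a list \<open>Sym_a\<close> or
  \<open>Sym_v\<close> would start a further item.\<close>

lemma code_item_inj:
  "item_over (set (alph S)) t \<Longrightarrow> item_over (set (alph S)) t' \<Longrightarrow>
   code_item S t @ r = code_item S t' @ r' \<Longrightarrow>
   r = [] \<or> hd r \<notin> {Accent, U_LPar} \<Longrightarrow> r' = [] \<or> hd r' \<notin> {Accent, U_LPar} \<Longrightarrow>
   t = t' \<and> r = r'"
  and code_list_inj:
  "\<forall>t\<in>set l. item_over (set (alph S)) t \<Longrightarrow> \<forall>t\<in>set l'. item_over (set (alph S)) t \<Longrightarrow>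
   code_list S l @ r = code_list S l' @ r' \<Longrightarrow>
   r = [] \<or> hd r \<notin> {Accent, U_LPar, Sym_a, Sym_v} \<Longrightarrow>
   r' = [] \<or> hd r' \<notin> {Accent, U_LPar, Sym_a, Sym_v} \<Longrightarrow>
   l = l' \<and> r = r'"
proof -
  have hd: "\<exists>h w. code_item S u = h # w \<and> h \<in> {Sym_a, Sym_v}" for u
    by (cases u) auto
  \<comment> \<open>Injectivity on the members of \<open>l\<close> is a premise, so that the case of
    an application can supply it from its induction hypothesis.\<close>
  have lst: "l = l' \<and> r = r'"
    if "\<And>t t' r r'. t \<in> set l \<Longrightarrow> item_over (set (alph S)) t' \<Longrightarrow> code_item S t @ r = code_item S t' @ r' \<Longrightarrow>
         r = [] \<or> hd r \<notin> {Accent, U_LPar} \<Longrightarrow> r' = [] \<or> hd r' \<notin> {Accent, U_LPar} \<Longrightarrow> t = t' \<and> r = r'"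
      and "\<forall>t\<in>set l'. item_over (set (alph S)) t"
      and "code_list S l @ r = code_list S l' @ r'"
      and r: "r = [] \<or> hd r \<notin> {Accent, U_LPar, Sym_a, Sym_v}"
        "r' = [] \<or> hd r' \<notin> {Accent, U_LPar, Sym_a, Sym_v}"
    for l l' r r'
    using that(1-3)
  proof (induction l arbitrary: l')
    case Nil
    have False if "l' = u # k" for u k
      using Nil(3) that hd[of u] r by auto
    then show ?case using Nil by (cases l') auto
  next
    case (Cons t l)
    have "l' \<noteq> []"
      using Cons.prems(3) hd[of t] r by auto
    then obtain t' l'' where l': "l' = t' # l''" by (cases l') auto
    have ok: "code_list S k @ s = [] \<or> hd (code_list S k @ s) \<notin> {Accent, U_LPar}"
      if "s = [] \<or> hd s \<notin> {Accent, U_LPar, Sym_a, Sym_v}" for k s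
      using that hd[of "hd k"] by (cases k) auto
    have "t = t' \<and> code_list S l @ r = code_list S l'' @ r'"
      by (rule Cons.prems(1)) (use Cons.prems l' ok[OF r(1)] ok[OF r(2)] in auto)
    moreover from this have "l = l'' \<and> r = r'"
      by (intro Cons.IH) (use Cons.prems l' in auto)
    ultimately show ?case using l' by simp
  qed
  show itm: "t = t' \<and> r = r'"
    if "item_over (set (alph S)) t" "item_over (set (alph S)) t'"
      "code_item S t @ r = code_item S t' @ r'"
      "r = [] \<or> hd r \<notin> {Accent, U_LPar}" "r' = [] \<or> hd r' \<notin> {Accent, U_LPar}" for t t' r r'
    using that
  proof (induction t arbitrary: t' r r')
    case (Con c)
    then show ?case
      by (cases t') (auto dest!: accents_append_eqD dest: posn_inj accents_inj)
  next
    case (Var x)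
    then show ?case
      by (cases t') (auto dest!: accents_append_eqD dest: accents_inj)
  next
    case (App f l)
    have acc: "accents m @ U_LPar # s = accents n @ s' \<Longrightarrow> s' = [] \<or> hd s' \<noteq> Accent \<Longrightarrow> m = n \<and> U_LPar # s = s'"
      for m n s s'
      by (rule accents_append_eqD) auto
    from App.prems obtain f' l' where t': "t' = App f' l'"
      by (cases t') (auto dest!: acc)
    with App.prems acc[of "posn (alph S) f" "code_list S l @ U_RPar # r" "posn (alph S) f'" "U_LPar # code_list S l' @ U_RPar # r'"]
    have *: "posn (alph S) f = posn (alph S) f'"
      "code_list S l @ U_RPar # r = code_list S l' @ U_RPar # r'"
      by auto
    have "l = l' \<and> U_RPar # r = U_RPar # r'"
    proof (rule lst[OF _ _ *(2)])
      show "\<forall>t\<in>set l'. item_over (set (alph S)) t" using App.prems(2) t' by simp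
    next
      fix t t' r r'
      assume "t \<in> set l"
      then show "item_over (set (alph S)) t' \<Longrightarrow> code_item S t @ r = code_item S t' @ r' \<Longrightarrow>
          r = [] \<or> hd r \<notin> {Accent, U_LPar} \<Longrightarrow> r' = [] \<or> hd r' \<notin> {Accent, U_LPar} \<Longrightarrow> t = t' \<and> r = r'"
        using App.IH[of t] App.prems(1) by simp
    qed auto
    then show ?case using posn_inj[OF _ _ *(1)] App.prems t' by auto
  qed
  show "l = l' \<and> r = r'"
    if "\<forall>t\<in>set l. item_over (set (alph S)) t" "\<forall>t\<in>set l'. item_over (set (alph S)) t"
      "code_list S l @ r = code_list S l' @ r'"
      "r = [] \<or> hd r \<notin> {Accent, U_LPar, Sym_a, Sym_v}"
      "r' = [] \<or> hd r' \<notin> {Accent, U_LPar, Sym_a, Sym_v}" for l l' r r'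
    by (rule lst[OF _ that(2-5)]) (use that(1) itm in blast)
qed

text \<open>The excluded symbols are those that could prolong the arguments of a prime formula.
  Inside an implication the next formula starts with \<open>U_Arrow\<close>, \<open>U_Sim\<close> or
  \<open>Sym_p\<close>, none of them excluded.\<close>

definition formula_end :: "csym list \<Rightarrow> bool" where
  "formula_end r \<longleftrightarrow> r = [] \<or> hd r \<notin> {Accent, U_LPar, Sym_a, Sym_v, U_Comma}"

lemma hd_code_list: "list_over A l \<Longrightarrow> code_list S l \<noteq> [] \<and> hd (code_list S l) \<in> {Sym_a, Sym_v}"
  by (cases l; cases "hd l") (auto simp: list_over_def)

lemma code_args_inj:
  assumes "\<forall>l\<in>set ls. list_over (set (alph S)) l" "\<forall>l\<in>set ls'. list_over (set (alph S)) l"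
    "code_args S ls @ r = code_args S ls' @ r'" "formula_end r" "formula_end r'"
  shows "ls = ls' \<and> r = r'"
  using assms
proof (induction ls arbitrary: ls')
  case Nil
  have False if "ls' = l # ks" for l ks
    using Nil that hd_code_list[of _ l S] by (auto simp: code_args_Cons formula_end_def)
  then show ?case using Nil by (cases ls') auto
next
  case (Cons l ls)
  have "ls' \<noteq> []"
    using Cons.prems hd_code_list[of _ l S] by (auto simp: code_args_Cons formula_end_def)
  then obtain l' ks where ls': "ls' = l' # ks" by (cases ls') auto
  let ?s = "\<lambda>ls r. if ls = [] then r else U_Comma # code_args S ls @ r"
  have "l = l' \<and> ?s ls r = ?s ks r'"
    by (rule code_list_inj[of _ S])
      (use Cons.prems ls' in \<open>auto simp: code_args_Cons formula_end_def list_over_def split: if_splits\<close>)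
  moreover from this have "(ls = [] \<longleftrightarrow> ks = [])"
    using Cons.prems by (auto simp: formula_end_def split: if_splits)
  moreover have "ls = ks \<and> r = r'" if "code_args S ls @ r = code_args S ks @ r'"
    by (rule Cons.IH) (use Cons.prems ls' that in auto)
  ultimately show ?case using ls' by (auto split: if_splits)
qed

lemma code_prime_inj:
  assumes "prime_of S F" "prime_of S F'" "code_prime S F @ r = code_prime S F' @ r'"
    "formula_end r" "formula_end r'"
  shows "F = F' \<and> r = r'"
proof (cases F)
  case (Equ l m)
  with assms(3) obtain l' m' where F': "F' = Equ l' m'" by (cases F') auto
  have "[l, m] = [l', m'] \<and> r = r'"
    by (rule code_args_inj[of _ S]) (use assms Equ F' in auto)
  with Equ F' show ?thesis by simp
next
  case (Pred p ls)
  with assms(3) obtain p' ls' where F': "F' = Pred p' ls'" by (cases F') auto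
  have acc: "code_args S ls @ r = [] \<or> hd (code_args S ls @ r) \<noteq> Accent"
    if "\<forall>l\<in>set ls. list_over (set (alph S)) l" "formula_end r" for ls r
    using that hd_code_list[of "set (alph S)" "hd ls" S]
    by (cases ls) (auto simp: formula_end_def code_args_Cons)
  have *: "posn (prds S) p = posn (prds S) p' \<and> code_args S ls @ r = code_args S ls' @ r'"
    by (rule accents_append_eqD[OF _ acc acc]) (use assms Pred F' in auto)
  have "ls = ls' \<and> r = r'"
    by (rule code_args_inj[of _ S]) (use assms * Pred F' in auto)
  with * Pred F' assms(1,2) show ?thesis using posn_inj by fastforce
qed

lemma code_rf_inj:
  "rformula_of S F \<Longrightarrow> rformula_of S F' \<Longrightarrow> code_rf S F = code_rf S F' \<Longrightarrow> F = F'"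
proof (induction F arbitrary: F')
  case (Prime F)
  obtain G where F': "F' = Prime G"
    using Prime by (cases F'; cases F) auto
  with code_prime_inj[of S F G "[]" "[]"] Prime show ?case by (auto simp: formula_end_def)
next
  case (Imp F G)
  obtain H K where F': "F' = Imp H K"
    using Imp.prems
  proof (cases F')
    case (Prime H) with Imp.prems show ?thesis by (cases H) auto
  qed auto
  have fe: "formula_end (code_rf S G)" for G
    by (cases G; cases "case G of Prime F \<Rightarrow> F | Imp F _ \<Rightarrow> F") (auto simp: formula_end_def)
  have "F = H \<and> code_rf S G = code_rf S K"
    by (rule code_prime_inj) (use Imp.prems F' fe in auto)
  with Imp F' show ?case by simp
qed

subsection \<open>Derivability depends on the code only\<close>

fun ren_item :: "(csym \<Rightarrow> csym) \<Rightarrow> item \<Rightarrow> item" where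
  "ren_item \<phi> (Con c) = Con (\<phi> c)"
| "ren_item \<phi> (Var x) = Var x"
| "ren_item \<phi> (App f l) = App (\<phi> f) (map (ren_item \<phi>) l)"

fun ren_prime :: "(csym \<Rightarrow> csym) \<Rightarrow> (nat \<Rightarrow> nat) \<Rightarrow> prime_rf \<Rightarrow> prime_rf" where
  "ren_prime \<phi> \<pi> (Equ l m) = Equ (map (ren_item \<phi>) l) (map (ren_item \<phi>) m)"
| "ren_prime \<phi> \<pi> (Pred p ls) = Pred (\<pi> p) (map (map (ren_item \<phi>)) ls)"

lemma ren_inst_item:
  "map (ren_item \<phi>) (inst_item \<sigma> t) = inst_item (\<lambda>x. map (ren_item \<phi>) (\<sigma> x)) (ren_item \<phi> t)"
proof (induction t)
  case (App f l)
  then have "map (ren_item \<phi>) (inst_list \<sigma> l) = inst_list (\<lambda>x. map (ren_item \<phi>) (\<sigma> x)) (map (ren_item \<phi>) l)"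
    by (induction l) auto
  then show ?case by simp
qed auto

lemma ren_inst_list:
  "map (ren_item \<phi>) (inst_list \<sigma> l) = inst_list (\<lambda>x. map (ren_item \<phi>) (\<sigma> x)) (map (ren_item \<phi>) l)"
  by (induction l) (auto simp: ren_inst_item)

lemma ren_subst_prime:
  "ren_prime \<phi> \<pi> (subst_prime x m F) = subst_prime x (map (ren_item \<phi>) m) (ren_prime \<phi> \<pi> F)"
proof -
  have "(\<lambda>y. map (ren_item \<phi>) (single x m y)) = single x (map (ren_item \<phi>) m)"
    by (auto simp: single_def)
  then show ?thesis by (cases F) (auto simp: subst_prime_inst ren_inst_list)
qed

lemma ren_subst_rf:
  "map_rf (ren_prime \<phi> \<pi>) (subst_rf x m F) = subst_rf x (map (ren_item \<phi>) m) (map_rf (ren_prime \<phi> \<pi>) F)"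
  by (induction F) (auto simp: ren_subst_prime)

lemma ren_list_over: "list_over A l \<Longrightarrow> \<phi> ` A \<subseteq> B \<Longrightarrow> list_over B (map (ren_item \<phi>) l)"
proof -
  assume "list_over A l" "\<phi> ` A \<subseteq> B"
  have "item_over A t \<Longrightarrow> item_over B (ren_item \<phi> t)" for t
    using \<open>\<phi> ` A \<subseteq> B\<close> by (induction t) auto
  then show ?thesis using \<open>list_over A l\<close> by (auto simp: list_over_def)
qed

lemma ren_prime_of:
  assumes "prime_of S F" "\<phi> ` set (alph S) \<subseteq> set (alph T)" "\<pi> ` set (prds S) \<subseteq> set (prds T)"
  shows "prime_of T (ren_prime \<phi> \<pi> F)"
  using assms by (cases F) (auto intro: ren_list_over)

lemma R_derivable_ren:
  assumes "R_derivable S F"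
    and "\<phi> ` set (alph S) \<subseteq> set (alph T)" "\<pi> ` set (prds S) \<subseteq> set (prds T)"
    and "map_rf (ren_prime \<phi> \<pi>) ` set (basis S) \<subseteq> set (basis T)"
  shows "R_derivable T (map_rf (ren_prime \<phi> \<pi>) F)"
  using assms(1)
proof induction
  case (basis_axiom F)
  then show ?case using assms(4) by (blast intro: R_derivable.basis_axiom)
next
  case (eq_refl x)
  then show ?case by (simp add: R_derivable.eq_refl)
next
  case (eq_repl F x y)
  then show ?case
    using R_derivable.eq_repl[OF ren_prime_of[OF eq_repl assms(2,3)], of x y]
    by (simp add: ren_subst_prime)
next
  case (modus_ponens F G)
  then show ?case by (auto intro: R_derivable.modus_ponens)
next
  case (substitution F m x)
  then show ?case
    by (auto simp: ren_subst_rf intro!: R_derivable.substitution ren_list_over[OF _ assms(2)])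
qed

lemma code_ren_item:
  assumes "\<And>c. c \<in> set (alph S) \<Longrightarrow> posn (alph T) (\<phi> c) = posn (alph S) c"
  shows "item_over (set (alph S)) t \<Longrightarrow> code_item T (ren_item \<phi> t) = code_item S t"
proof (induction t)
  case (App f l)
  then have "code_list T (map (ren_item \<phi>) l) = code_list S l"
    by (auto simp: code_list_def intro!: arg_cong[of _ _ concat])
  then show ?case using assms App by simp
qed (auto simp: assms)

lemma code_ren_list:
  assumes "\<And>c. c \<in> set (alph S) \<Longrightarrow> posn (alph T) (\<phi> c) = posn (alph S) c"
  shows "list_over (set (alph S)) l \<Longrightarrow> code_list T (map (ren_item \<phi>) l) = code_list S l"
  using code_ren_item[of S T \<phi>, OF assms]
  by (auto simp: code_list_def list_over_def intro!: arg_cong[of _ _ concat])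

lemma code_ren_prime:
  assumes "\<And>c. c \<in> set (alph S) \<Longrightarrow> posn (alph T) (\<phi> c) = posn (alph S) c"
    "\<And>p. p \<in> set (prds S) \<Longrightarrow> posn (prds T) (\<pi> p) = posn (prds S) p"
    "prime_of S F"
  shows "code_prime T (ren_prime \<phi> \<pi> F) = code_prime S F"
proof -
  have "code_args T (map (map (ren_item \<phi>)) ls) = code_args S ls"
    if "\<forall>l\<in>set ls. list_over (set (alph S)) l" for ls
    using that by (induction ls) (auto simp: code_args_Cons code_ren_list[of S T \<phi>, OF assms(1)])
  from this[of "[l, m]" for l m] this show ?thesis
    using assms(2,3) by (cases F) auto
qed

lemma code_ren_rf:
  assumes "\<And>c. c \<in> set (alph S) \<Longrightarrow> posn (alph T) (\<phi> c) = posn (alph S) c"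
    "\<And>p. p \<in> set (prds S) \<Longrightarrow> posn (prds T) (\<pi> p) = posn (prds S) p"
    "rformula_of S F"
  shows "code_rf T (map_rf (ren_prime \<phi> \<pi>) F) = code_rf S F"
  using assms(3) by (induction F) (auto simp: code_ren_prime[of S T \<phi> \<pi>, OF assms(1,2)])

lemma ren_rformula_of:
  assumes "rformula_of S F" "\<phi> ` set (alph S) \<subseteq> set (alph T)" "\<pi> ` set (prds S) \<subseteq> set (prds T)"
  shows "rformula_of T (map_rf (ren_prime \<phi> \<pi>) F)"
  using assms(1) by (induction F) (auto intro: ren_prime_of[OF _ assms(2,3)])

definition same_posn :: "'a list \<Rightarrow> 'a list \<Rightarrow> 'a \<Rightarrow> 'a" where
  "same_posn xs ys a = ys ! (posn xs a - 1)"

lemma same_posn: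
  assumes "a \<in> set xs" "length xs = length ys" "distinct ys"
  shows "same_posn xs ys a \<in> set ys" "posn ys (same_posn xs ys a) = posn xs a"
proof -
  obtain i where i: "posn xs a = Suc i" using posn_pos by metis
  with posn_le[OF assms(1)] assms(2) have "i < length ys" by simp
  with i assms(3) show "same_posn xs ys a \<in> set ys" "posn ys (same_posn xs ys a) = posn xs a"
    by (simp_all add: same_posn_def posn_nth)
qed

text \<open>Renaming symbols by position maps an axiom of \<open>S\<close> to a formula of
  \<open>T\<close> with the code of an axiom of \<open>T\<close>, hence to that axiom by unique
  decoding. Derivations are thereby mapped to derivations.\<close>

theorem derivable_if_code_eq:
  assumes S: "recursive_system S" and T: "recursive_system T"
    and basis: "basis_string S = basis_string T"
    and F: "prime_of S F" "der S F" and G: "prime_of T G" "code_prime S F = code_prime T G"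
  shows "der T G"
proof -
  note len = basis_string_inj(1,2)[OF basis]
  let ?\<phi> = "same_posn (alph S) (alph T)" and ?\<pi> = "same_posn (prds S) (prds T)"
  have d: "distinct (alph T)" "distinct (prds T)" using T by (auto simp: recursive_system_def)
  have posn: "c \<in> set (alph S) \<Longrightarrow> posn (alph T) (?\<phi> c) = posn (alph S) c"
    "p \<in> set (prds S) \<Longrightarrow> posn (prds T) (?\<pi> p) = posn (prds S) p" for c p
    using same_posn(2)[OF _ len(1) d(1)] same_posn(2)[OF _ len(2) d(2)] by simp_all
  have im: "?\<phi> ` set (alph S) \<subseteq> set (alph T)" "?\<pi> ` set (prds S) \<subseteq> set (prds T)"
    using same_posn(1)[OF _ len(1) d(1)] same_posn(1)[OF _ len(2) d(2)] by auto
  have "map_rf (ren_prime ?\<phi> ?\<pi>) H \<in> set (basis T)" if H: "H \<in> set (basis S)" for H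
  proof -
    from H have "code_rf S H \<in> set (map (code_rf S) (basis S))" by simp
    then have "code_rf S H \<in> set (map (code_rf T) (basis T))"
      unfolding basis_string_inj(3)[OF basis] .
    then obtain K where K: "K \<in> set (basis T)" "code_rf T K = code_rf S H" by auto
    have "rformula_of S H" "rformula_of T K" using H K(1) S T by (auto simp: recursive_system_def)
    then have "map_rf (ren_prime ?\<phi> ?\<pi>) H = K"
      using code_ren_rf[of S T ?\<phi> ?\<pi> H, OF posn] ren_rformula_of[of S H, OF _ im] K(2)
      by (intro code_rf_inj[of T]) auto
    with K show ?thesis by simp
  qed
  then have "der T (ren_prime ?\<phi> ?\<pi> F)"
    using R_derivable_ren[OF F(2) im] by (auto simp: image_subset_iff)
  moreover have "ren_prime ?\<phi> ?\<pi> F = G"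
    using code_prime_inj[of T _ G "[]" "[]"] ren_prime_of[OF F(1) im] G
      code_ren_prime[of S T ?\<phi> ?\<pi> F, OF posn F(1)]
    by (auto simp: formula_end_def)
  ultimately show ?thesis by simp
qed

text \<open>The definition of \<open>\<Omega>\<close> only supplies some system and some formula
  with the given code. The boundary inside the string is unique, and
  \<open>derivable_if_code_eq\<close> carries derivability over to \<open>S\<close>.\<close>

theorem universal_iff:
  assumes U: "universal_system S11 \<Omega>"
    and S: "recursive_system S" "prime_of S F" "elem_prime F"
  shows "der S11 (Pred \<Omega> [str (basis_string S @ code_prime S F)]) \<longleftrightarrow> der S F"
proof -
  have "set (basis_string S @ code_prime S F) \<subseteq> set A11"
    using set_basis_string[of S] set_code_prime[of S F] by (auto simp: set_A11)
  then have L: "der S11 (Pred \<Omega> [str (basis_string S @ code_prime S F)]) \<longleftrightarrow>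
      (\<exists>y x T G. basis_string S @ code_prime S F = y @ x \<and> recursive_system T \<and>
      y = basis_string T \<and> prime_of T G \<and> elem_prime G \<and> x = code_prime T G \<and> der T G)"
    using U unfolding universal_system_def by blast
  show ?thesis unfolding L
  proof
    assume "\<exists>y x T G. basis_string S @ code_prime S F = y @ x \<and> recursive_system T \<and>
      y = basis_string T \<and> prime_of T G \<and> elem_prime G \<and> x = code_prime T G \<and> der T G"
    then obtain T G where T: "basis_string S @ code_prime S F = basis_string T @ code_prime T G"
      "recursive_system T" "prime_of T G" "der T G" by blast
    then have "basis_string S = basis_string T" "code_prime S F = code_prime T G"
      using split_statement[OF T(1) code_prime_no_Star code_prime_no_Star] by auto
    then show "der S F" using derivable_if_code_eq[OF T(2) S(1) _ T(3,4) S(2)] by simp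
  qed (use S in blast)
qed

subsection \<open>Encoded unary statements\<close>

text \<open>A grammar for the codes of elementary lists over arbitrary alphabets, hence without a
  bound on indices. Its clauses reappear as rules of the system that represents the unary
  statements.\<close>

inductive list_code :: "csym list \<Rightarrow> bool" where
  Con: "list_code (Sym_a # accents (Suc n))"
| App: "list_code w \<Longrightarrow> list_code (Sym_a # accents (Suc n) @ [U_LPar] @ w @ [U_RPar])"
| append: "list_code v \<Longrightarrow> list_code w \<Longrightarrow> list_code (v @ w)"

lemma list_code_code_list:
  assumes "l \<noteq> []" "\<forall>t\<in>set l. item_over A t \<and> elem_item t"
  shows "list_code (code_list S l)"
proof -
  have lst: "list_code (code_list S l)" if "l \<noteq> []" "\<And>t. t \<in> set l \<Longrightarrow> list_code (code_item S t)" for l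
    using that
  proof (induction l)
    case (Cons t l)
    then show ?case by (cases "l = []") (auto intro: append)
  qed simp
  have "item_over A t \<Longrightarrow> elem_item t \<Longrightarrow> list_code (code_item S t)" for t
  proof (induction t)
    case (Con c)
    then show ?case using posn_pos[of "alph S" c] by (auto intro: list_code.Con)
  next
    case (App f l)
    then show ?case using posn_pos[of "alph S" f] list_code.App[OF lst[of l]] by auto
  qed simp
  with assms show ?thesis by (intro lst) auto
qed

text \<open>A supply of systems for encoded formulas: finitely many indices are all available once
  \<open>n\<close> is large enough.\<close>

definition bare_system :: "nat \<Rightarrow> recsys" where
  "bare_system n = \<lparr>alph = map Other [0..<n], prds = [0..<n], basis = []\<rparr>"

lemma posn_bare_system:
  "i < n \<Longrightarrow> posn (alph (bare_system n)) (Other i) = Suc i"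
  "i < n \<Longrightarrow> posn (prds (bare_system n)) i = Suc i"
  using posn_nth[of "map Other [0..<n]" i] posn_nth[of "[0..<n]" i]
  by (auto simp: bare_system_def distinct_map inj_on_def)

text \<open>The threshold on \<open>n\<close>, in place of a single witness, lets both parts of a
  concatenation be decoded in the same system.\<close>

lemma list_code_bare_system:
  assumes "list_code w"
  shows "\<exists>m. \<forall>n\<ge>m. \<exists>l. ground_over (set (alph (bare_system n))) l \<and> code_list (bare_system n) l = w"
  using assms
proof induction
  case (Con i)
  show ?case
    by (rule exI[of _ "Suc i"])
      (auto simp: Suc_le_eq posn_bare_system ground_over_def list_over_def elem_list_def
        intro!: exI[of _ "[item.Con (Other i)]"], simp add: bare_system_def)
next
  case (App w i)
  then obtain m where m: "\<forall>n\<ge>m. \<exists>l. ground_over (set (alph (bare_system n))) l \<and> code_list (bare_system n) l = w"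
    by blast
  show ?case
  proof (rule exI[of _ "max m (Suc i)"], intro allI impI)
    fix n
    assume n: "max m (Suc i) \<le> n"
    then obtain l where l: "ground_over (set (alph (bare_system n))) l" "code_list (bare_system n) l = w"
      using m by auto
    then show "\<exists>l. ground_over (set (alph (bare_system n))) l \<and>
        code_list (bare_system n) l = Sym_a # accents (Suc i) @ [U_LPar] @ w @ [U_RPar]"
      using n
      by (intro exI[of _ "[item.App (Other i) l]"])
        (auto simp: Suc_le_eq posn_bare_system intro!: ground_over_App, simp add: bare_system_def)
  qed
next
  case (append v w)
  then obtain m k where
    "\<forall>n\<ge>m. \<exists>l. ground_over (set (alph (bare_system n))) l \<and> code_list (bare_system n) l = v"
    "\<forall>n\<ge>k. \<exists>l. ground_over (set (alph (bare_system n))) l \<and> code_list (bare_system n) l = w"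
    by blast
  then show ?case
    by (intro exI[of _ "max m k"]) (auto, metis code_list_simps(3) ground_over_append)
qed

text \<open>The formula may come from any system, so its symbols can have arbitrary positions. The
  condition on it thus separates from the basis string and becomes the grammar
  \<open>list_code\<close>.\<close>

lemma unary_statements_eq:
  "unary_statements =
    {basis_string S @ Sym_p # accents (Suc n) @ w | S n w. recursive_system S \<and> list_code w}"
proof (intro equalityI subsetI)
  fix z
  assume "z \<in> unary_statements"
  then obtain S T p l where *: "recursive_system S" "prime_of T (Pred p [l])" "elem_prime (Pred p [l])"
    "z = basis_string S @ code_prime T (Pred p [l])"
    by (auto simp: unary_statements_def statement_of_def)
  then have "list_code (code_list T l)"
    by (intro list_code_code_list[of _ "set (alph T)"]) (auto simp: list_over_def elem_list_def)
  moreover obtain i where "posn (prds T) p = Suc i" using posn_pos by metis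
  ultimately show "z \<in> {basis_string S @ Sym_p # accents (Suc n) @ w | S n w. recursive_system S \<and> list_code w}"
    using *(1,4) by (auto intro!: exI[of _ S] exI[of _ i] exI[of _ "code_list T l"])
next
  fix z
  assume "z \<in> {basis_string S @ Sym_p # accents (Suc n) @ w | S n w. recursive_system S \<and> list_code w}"
  then obtain S i w where z: "recursive_system S" "list_code w" "z = basis_string S @ Sym_p # accents (Suc i) @ w"
    by blast
  obtain m where "\<forall>n\<ge>m. \<exists>l. ground_over (set (alph (bare_system n))) l \<and> code_list (bare_system n) l = w"
    using list_code_bare_system[OF z(2)] by blast
  then obtain l where l: "ground_over (set (alph (bare_system (max m (Suc i))))) l"
    "code_list (bare_system (max m (Suc i))) l = w"
    by (meson max.cobounded1)
  have "recursive_system (bare_system (max m (Suc i)))"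
    by (auto simp: recursive_system_def bare_system_def distinct_map inj_on_def)
  moreover have "i \<in> set (prds (bare_system (max m (Suc i))))" by (simp add: bare_system_def)
  ultimately have "statement_of z S (bare_system (max m (Suc i))) (Pred i [l])"
    using z l by (auto simp: statement_of_def ground_over_def posn_bare_system)
  then show "z \<in> unary_statements" by (auto simp: unary_statements_def)
qed

subsection \<open>Recognising basis strings\<close>

text \<open>The code of \<open>~a_1,a_1\<close>, which is derivable in every system that has a
  constant.\<close>

definition tautology :: "csym list" where
  "tautology = [U_Sim, Sym_a, Accent, U_Comma, Sym_a, Accent]"

lemma not_list_over_empty: "elem_list l \<Longrightarrow> \<not> list_over {} l"
  by (cases l; cases "hd l") (auto simp: list_over_def elem_list_def)

text \<open>\<open>tautology\<close> contains no star, so the last star shows which part is the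
  basis string. An elementary equation requires a constant, which is why systems with an empty
  alphabet escape this test.\<close>

lemma universal_tautology_iff:
  assumes U: "universal_system S11 \<Omega>" and x: "set x \<subseteq> set A11"
  shows "der S11 (Pred \<Omega> [str (x @ Star # tautology)]) \<longleftrightarrow>
    (\<exists>S. recursive_system S \<and> alph S \<noteq> [] \<and> basis_string S = x @ [Star])"
    (is "?L \<longleftrightarrow> ?R")
proof -
  have "set (x @ Star # tautology) \<subseteq> set A11"
    using x by (auto simp: tautology_def set_A11)
  then have L: "?L \<longleftrightarrow> (\<exists>y x' S F. x @ Star # tautology = y @ x' \<and> recursive_system S \<and>
      y = basis_string S \<and> prime_of S F \<and> elem_prime F \<and> x' = code_prime S F \<and> der S F)"
    using U unfolding universal_system_def by blast
  show ?thesis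
  proof
    assume ?L
    then obtain S F where *: "x @ Star # tautology = basis_string S @ code_prime S F" "recursive_system S"
      "prime_of S F" "elem_prime F"
      unfolding L by blast
    obtain w where w: "basis_string S = w @ [Star]" using basis_string_snoc by blast
    have "x = w \<and> tautology = code_prime S F"
      by (rule append_delimiter_eqD'[of _ Star])
        (use * w code_prime_no_Star in \<open>auto simp: tautology_def\<close>)
    moreover from this obtain l m where "F = Equ l m"
      by (cases F) (auto simp: tautology_def)
    then have "alph S \<noteq> []" using * not_list_over_empty[of l] by auto
    ultimately show ?R using * w by auto
  next
    assume ?R
    then obtain S where S: "recursive_system S" "alph S \<noteq> []" "basis_string S = x @ [Star]" by blast
    let ?F = "Equ [Con (hd (alph S))] [Con (hd (alph S))]"
    have c: "list_over (set (alph S)) [Con (hd (alph S))]"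
      using S(2) by (simp add: list_over_def)
    have "posn (alph S) (hd (alph S)) = 1" using S(2) by (cases "alph S") (auto simp: posn_def)
    then have "code_prime S ?F = tautology" by (simp add: tautology_def accents_def)
    then show ?L unfolding L
      using S c der_refl[OF c]
      by (intro exI[of _ "basis_string S"] exI[of _ tautology] exI[of _ S] exI[of _ ?F])
        (auto simp: elem_list_def)
  qed
qed

section \<open>Systems without constants\<close>

lemma item_over_empty: "item_over {} t \<longleftrightarrow> Sym_a \<notin> set (code_item S t)"
  using set_accents by (cases t) auto

lemma code_item_alph: "item_over {} t \<Longrightarrow> code_item (S\<lparr>alph := A\<rparr>) t = code_item S t"
  by (cases t) auto

lemma list_over_empty: "list_over {} l \<longleftrightarrow> l \<noteq> [] \<and> Sym_a \<notin> set (code_list S l)"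
  using item_over_empty[of _ S] by (auto simp: list_over_def code_list_def)

lemma code_list_alph: "list_over {} l \<Longrightarrow> code_list (S\<lparr>alph := A\<rparr>) l = code_list S l"
  by (auto simp: list_over_def code_list_def code_item_alph intro!: arg_cong[of _ _ concat])

lemma code_args_alph:
  "\<forall>l\<in>set ls. list_over {} l \<Longrightarrow> code_args (S\<lparr>alph := A\<rparr>) ls = code_args S ls"
  by (induction ls) (auto simp: code_args_Cons code_list_alph)

lemma args_over_empty:
  "\<forall>l\<in>set ls. l \<noteq> [] \<Longrightarrow> (\<forall>l\<in>set ls. list_over {} l) \<longleftrightarrow> Sym_a \<notin> set (code_args S ls)"
  using list_over_empty[of _ S] by (induction ls) (auto simp: code_args_Cons)

text \<open>Constants and function symbols alike are coded with \<open>Sym_a\<close>, so its absence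
  means that the formula uses no symbol of the alphabet.\<close>

lemma prime_of_empty:
  assumes "prime_of S F"
  shows "prime_of (S\<lparr>alph := []\<rparr>) F \<longleftrightarrow> Sym_a \<notin> set (code_prime S F)"
proof (cases F)
  case (Equ l m)
  then show ?thesis using assms args_over_empty[of "[l, m]" S] by (auto simp: list_over_def)
next
  case (Pred p ls)
  then show ?thesis using assms args_over_empty[of ls S] set_accents by (auto simp: list_over_def)
qed

lemma code_prime_alph:
  "prime_of (S\<lparr>alph := []\<rparr>) F \<Longrightarrow> code_prime (S\<lparr>alph := A\<rparr>) F = code_prime S F"
  using code_args_alph[of "[_, _]" A S] by (cases F) (auto simp: code_args_alph)

lemma rformula_of_empty:
  "rformula_of S F \<Longrightarrow> rformula_of (S\<lparr>alph := []\<rparr>) F \<longleftrightarrow> Sym_a \<notin> set (code_rf S F)"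
  by (induction F) (auto simp: prime_of_empty)

lemma code_rf_alph:
  "rformula_of (S\<lparr>alph := []\<rparr>) F \<Longrightarrow> code_rf (S\<lparr>alph := A\<rparr>) F = code_rf S F"
  by (induction F) (auto simp: code_prime_alph)

lemma rformula_of_alph_mono:
  assumes "rformula_of (S\<lparr>alph := []\<rparr>) F"
  shows "rformula_of (S\<lparr>alph := A\<rparr>) F"
proof -
  have "prime_of (S\<lparr>alph := A\<rparr>) F" if "prime_of (S\<lparr>alph := []\<rparr>) F" for F
    using that by (cases F) (auto intro: list_over_mono)
  then show ?thesis using assms by (induction F) auto
qed

lemma Sym_a_code_basis:
  "Sym_a \<in> set (code_basis S B) \<longleftrightarrow> (\<exists>F\<in>set B. Sym_a \<in> set (code_rf S F))"
  by (auto simp: code_basis_def)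

lemma code_basis_cong:
  "(\<And>F. F \<in> set B \<Longrightarrow> code_rf S F = code_rf T F) \<Longrightarrow> code_basis S B = code_basis T B"
  by (auto simp: code_basis_def intro!: arg_cong[of _ _ concat])

lemma Sym_a_tally [simp]: "Sym_a \<notin> set (tally n)"
  using set_tally[of n] by auto

lemma basis_string_empty_alph_iff:
  "(\<exists>S. recursive_system S \<and> alph S = [] \<and> basis_string S = Box # Star # x) \<longleftrightarrow>
   Sym_a \<notin> set x \<and> (\<exists>S. recursive_system S \<and> alph S \<noteq> [] \<and> basis_string S = Accent # Star # x)"
   (is "?L \<longleftrightarrow> ?R")
proof
  assume ?L
  then obtain S where S: "recursive_system S" "alph S = []" "basis_string S = Box # Star # x" by blast
  \<comment> \<open>Any letter would serve, since codes see only its position.\<close>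
  let ?S = "S\<lparr>alph := [Sym_a]\<rparr>"
  have triv: "S\<lparr>alph := []\<rparr> = S" using S(2) by simp
  have F: "rformula_of (S\<lparr>alph := []\<rparr>) F" if "F \<in> set (basis S)" for F
    using S(1) that by (auto simp: triv recursive_system_def)
  have "recursive_system ?S"
    using S(1) rformula_of_alph_mono[OF F] by (auto simp: recursive_system_def)
  moreover have "code_basis ?S (basis S) = code_basis S (basis S)"
    using code_rf_alph[OF F] by (intro code_basis_cong)
  then have "basis_string ?S = Accent # Star # x"
    using S(2,3) by (simp add: basis_string_eq tally_def accents_def)
  moreover have "Sym_a \<notin> set (code_basis S (basis S))"
    using rformula_of_empty[of S] F S(1) by (auto simp: Sym_a_code_basis recursive_system_def)
  then have "Sym_a \<notin> set x"
    using S(2,3) by (auto simp: basis_string_eq tally_def[of 0])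
  ultimately show ?R by (intro conjI exI[of _ ?S]) auto
next
  assume ?R
  then obtain S where S: "recursive_system S" "basis_string S = Accent # Star # x" "Sym_a \<notin> set x" by blast
  let ?S = "S\<lparr>alph := []\<rparr>"
  have *: "tally (length (alph S)) = [Accent] \<and> tally (length (prds S)) @ Star # code_basis S (basis S) = x"
    by (rule append_delimiter_eqD[of _ Star]) (use S(2) tally_no_Star in \<open>auto simp: basis_string_eq\<close>)
  then have "Sym_a \<notin> set (code_basis S (basis S))" using S(3) by auto
  then have F: "rformula_of ?S F" if "F \<in> set (basis S)" for F
    using that S(1) rformula_of_empty[of S F] by (auto simp: Sym_a_code_basis recursive_system_def)
  have "recursive_system ?S" using S(1) F by (auto simp: recursive_system_def)
  moreover have "code_basis ?S (basis S) = code_basis S (basis S)"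
    using code_rf_alph[OF F] by (intro code_basis_cong)
  then have "basis_string ?S = Box # Star # x"
    using * by (simp add: basis_string_eq tally_def[of 0])
  ultimately show ?L by (intro exI[of _ ?S]) auto
qed

section \<open>The unary statements and theorems are recursively enumerable\<close>

definition word_rules :: "nat \<Rightarrow> csym list \<Rightarrow> rformula list" where
  "word_rules q cs = map (\<lambda>c. Prime (Pred q [[Con c]])) cs @
     map (\<lambda>c. Imp (Pred q [[Var 0]]) (Prime (Pred q [[Var 0, Con c]]))) cs"

text \<open>
  The predicates \<open>e + 1, \<dots>, e + 6\<close> mean: positive number of accents, code of an
  elementary list, word without \<open>Sym_a\<close>, word, unary statement, unary theorem. No
  grammar for basis strings is needed: \<open>y\<close> is the basis string of a system with
  nonempty alphabet iff \<open>\<Omega>\<close> holds of \<open>y\<close> followed by the code of \<open>\<sim>a\<^sub>1,a\<^sub>1\<close>, and an empty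
  alphabet is reduced to a one-letter alphabet whose letter does not occur in the axioms.
\<close>

definition statement_rules :: "nat \<Rightarrow> nat \<Rightarrow> rformula list" where
  "statement_rules e \<Omega> =
    [Prime (Pred (e+1) [[Con Accent]]),
     Imp (Pred (e+1) [[Var 0]]) (Prime (Pred (e+1) [[Var 0, Con Accent]])),
     Imp (Pred (e+1) [[Var 0]]) (Prime (Pred (e+2) [[Con Sym_a, Var 0]])),
     Imp (Pred (e+1) [[Var 0]]) (Imp (Pred (e+2) [[Var 1]])
       (Prime (Pred (e+2) [[Con Sym_a, Var 0, Con U_LPar, Var 1, Con U_RPar]]))),
     Imp (Pred (e+2) [[Var 0]]) (Imp (Pred (e+2) [[Var 1]]) (Prime (Pred (e+2) [[Var 0, Var 1]]))),
     Imp (Pred (e+4) [[Var 0]]) (Imp (Pred \<Omega> [Var 0 # str (Star # tautology)])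
       (Imp (Pred (e+1) [[Var 1]]) (Imp (Pred (e+2) [[Var 2]])
         (Prime (Pred (e+5) [[Var 0, Con Star, Con Sym_p, Var 1, Var 2]]))))),
     Imp (Pred (e+3) [[Var 0]]) (Imp (Pred \<Omega> [Con Accent # Con Star # Var 0 # str (Star # tautology)])
       (Imp (Pred (e+1) [[Var 1]]) (Imp (Pred (e+2) [[Var 2]])
         (Prime (Pred (e+5) [[Con Box, Con Star, Var 0, Con Star, Con Sym_p, Var 1, Var 2]]))))),
     Imp (Pred (e+5) [[Var 0]]) (Imp (Pred \<Omega> [[Var 0]]) (Prime (Pred (e+6) [[Var 0]])))]
    @ word_rules (e+3) (filter (\<lambda>c. c \<noteq> Sym_a) A11) @ word_rules (e+4) A11"

definition statement_system :: "recsys \<Rightarrow> nat \<Rightarrow> recsys" where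
  "statement_system S11 \<Omega> = eq_free_ext S11 6 (statement_rules (fresh_pred S11) \<Omega>)"

definition statement_interp :: "recsys \<Rightarrow> nat \<Rightarrow> nat \<Rightarrow> item list list \<Rightarrow> bool" where
  "statement_interp S11 \<Omega> r ls \<longleftrightarrow> (\<exists>z. ls = [str z] \<and>
     (let i = r - fresh_pred S11 in
        (i = 1 \<longrightarrow> (\<exists>n. z = accents (Suc n))) \<and>
        (i = 2 \<longrightarrow> list_code z) \<and>
        (i = 3 \<longrightarrow> z \<noteq> [] \<and> set z \<subseteq> set A11 - {Sym_a}) \<and>
        (i = 4 \<longrightarrow> z \<noteq> [] \<and> set z \<subseteq> set A11) \<and>
        (i = 5 \<longrightarrow> z \<in> unary_statements) \<and>
        (i = 6 \<longrightarrow> z \<in> unary_theorems S11 \<Omega>)))"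

lemma unary_statementsI:
  "recursive_system S \<Longrightarrow> basis_string S = y \<Longrightarrow> list_code w \<Longrightarrow>
   y @ Sym_p # accents (Suc n) @ w \<in> unary_statements"
  unfolding unary_statements_eq by blast

lemma unary_theorems_iff:
  "z \<in> unary_theorems S11 \<Omega> \<longleftrightarrow> z \<in> unary_statements \<and> der S11 (Pred \<Omega> [str z])"
  by (auto simp: unary_theorems_def S11_theorems_def S11_statements_def unary_statements_def)

lemma set_accents_A11: "set (accents n) \<subseteq> set A11"
  using set_accents by (auto simp: set_A11)

lemma set_list_code: "list_code w \<Longrightarrow> set w \<subseteq> set A11"
  by (induction rule: list_code.induct) (use set_accents_A11 in \<open>auto simp: set_A11\<close>)

lemma set_unary_statements: "z \<in> unary_statements \<Longrightarrow> z \<noteq> [] \<and> set z \<subseteq> set A11"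
proof -
  assume "z \<in> unary_statements"
  then obtain S n w where "list_code w" "z = basis_string S @ [Sym_p] @ accents (Suc n) @ w"
    by (auto simp: unary_statements_eq)
  moreover have "set [Sym_p] \<subseteq> set A11" by (simp add: set_A11)
  ultimately show ?thesis
    using set_basis_string[of S] set_accents_A11[of "Suc n"] set_list_code[of w] by simp
qed

section \<open>Soundness of the statement rules\<close>

context
  fixes S11 :: recsys and \<Omega> :: nat
  assumes U: "universal_system S11 \<Omega>"
begin

lemma universal_system_facts: "recursive_system S11" "alph S11 = A11" "alph S11 \<noteq> []" "\<Omega> \<in> set (prds S11)"
  using U by (auto simp: universal_system_def A11_def)

text \<open>\<open>universal_system\<close> constrains \<open>\<Omega>\<close> only on strings over
  \<open>A11\<close>, whereas variables may be instantiated by lists with applications. In the two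
  rules that produce statements, the word predicates \<open>e+3\<close> and \<open>e+4\<close>
  confine the basis string to such strings.\<close>

lemma statement_rules_valid:
  assumes "G \<in> set (statement_rules (fresh_pred S11) \<Omega>)"
  shows "horn (ext_model S11 (statement_interp S11 \<Omega>)) (inst_rf \<sigma> G)"
proof -
  let ?e = "fresh_pred S11" and ?M = "ext_model S11 (statement_interp S11 \<Omega>)"
  have M: "?M (Pred \<Omega> ls) \<longleftrightarrow> der S11 (Pred \<Omega> ls)" for ls
    using fresh_pred_notin[OF universal_system_facts(4)] universal_system_facts(4) by (simp add: ext_model_def)
  have "?e + Suc i \<notin> set (prds S11)" for i
    using fresh_pred_notin[of "?e + Suc i" S11] by auto
  then have K: "?M (Pred (?e + Suc i) ls) \<longleftrightarrow> statement_interp S11 \<Omega> (?e + Suc i) ls" for i ls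
    by (simp add: ext_model_def)
  have nums: "?e+1 = ?e + Suc 0" "?e+2 = ?e + Suc 1" "?e+3 = ?e + Suc 2" "?e+4 = ?e + Suc 3"
     "?e+5 = ?e + Suc 4" "?e+6 = ?e + Suc 5" by auto
  note K' = K[of 0, folded nums] K[of 1, folded nums] K[of 2, folded nums] K[of 3, folded nums]
    K[of 4, folded nums] K[of 5, folded nums]
  have I: "statement_interp S11 \<Omega> (?e+1) [l] \<longleftrightarrow> l \<in> str ` range (\<lambda>n. accents (Suc n))"
    "statement_interp S11 \<Omega> (?e+2) [l] \<longleftrightarrow> l \<in> str ` Collect list_code"
    "statement_interp S11 \<Omega> (?e+3) [l] \<longleftrightarrow> l \<in> str ` {z. z \<noteq> [] \<and> set z \<subseteq> set A11 - {Sym_a}}"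
    "statement_interp S11 \<Omega> (?e+4) [l] \<longleftrightarrow> l \<in> str ` {z. z \<noteq> [] \<and> set z \<subseteq> set A11}"
    "statement_interp S11 \<Omega> (?e+5) [l] \<longleftrightarrow> l \<in> str ` unary_statements"
    "statement_interp S11 \<Omega> (?e+6) [l] \<longleftrightarrow> l \<in> str ` unary_theorems S11 \<Omega>" for l
    by (auto simp: statement_interp_def)
  have word: "horn ?M (inst_rf \<sigma> G)"
    if "G \<in> set (word_rules q cs)"
      "\<And>l. ?M (Pred q [l]) \<longleftrightarrow> l \<in> str ` {z. z \<noteq> [] \<and> set z \<subseteq> set cs}" for q cs
  proof -
    from that(1) consider c where "c \<in> set cs" "G = Prime (Pred q [[Con c]])"
      | c where "c \<in> set cs" "G = Imp (Pred q [[Var 0]]) (Prime (Pred q [[Var 0, Con c]]))"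
      by (auto simp: word_rules_def)
    then show ?thesis
    proof cases
      case 1
      then show ?thesis using image_eqI[of "[Con c]" str "[c]"] by (simp add: that(2))
    next
      case 2
      have "\<sigma> 0 @ [Con c] \<in> str ` {z. z \<noteq> [] \<and> set z \<subseteq> set cs}"
        if "\<sigma> 0 = str z" "set z \<subseteq> set cs" for z
        using that 2(1) by (intro image_eqI[of _ _ "z @ [c]"]) auto
      then show ?thesis using 2(2) by (auto simp: that(2))
    qed
  qed
  have stmt1: "str x @ [Con Star, Con Sym_p] @ str (accents (Suc n)) @ str w \<in> str ` unary_statements"
    if "set x \<subseteq> set A11" "der S11 (Pred \<Omega> [str x @ str (Star # tautology)])" "list_code w" for x n w
  proof -
    have "der S11 (Pred \<Omega> [str (x @ Star # tautology)])" using that(2) by simp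
    then obtain S where "recursive_system S" "basis_string S = x @ [Star]"
      unfolding universal_tautology_iff[OF U \<open>set x \<subseteq> set A11\<close>] by blast
    from unary_statementsI[OF this \<open>list_code w\<close>, of n]
    have "str ((x @ [Star]) @ Sym_p # accents (Suc n) @ w) \<in> str ` unary_statements" by (rule imageI)
    then show ?thesis by simp
  qed
  have stmt2: "[Con Box, Con Star] @ str x @ [Con Star, Con Sym_p] @ str (accents (Suc n)) @ str w
      \<in> str ` unary_statements"
    if "set x \<subseteq> set A11 - {Sym_a}" "der S11 (Pred \<Omega> [[Con Accent, Con Star] @ str x @ str (Star # tautology)])"
      "list_code w" for x n w
  proof -
    have x: "set (Accent # Star # x) \<subseteq> set A11" using that(1) by (auto simp: set_A11)
    have "der S11 (Pred \<Omega> [str ((Accent # Star # x) @ Star # tautology)])" using that(2) by simp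
    then have "\<exists>S. recursive_system S \<and> alph S \<noteq> [] \<and> basis_string S = Accent # Star # x @ [Star]"
      unfolding universal_tautology_iff[OF U x] by simp
    moreover have "Sym_a \<notin> set (x @ [Star])" using that(1) by auto
    ultimately obtain S where "recursive_system S" "basis_string S = Box # Star # x @ [Star]"
      using basis_string_empty_alph_iff[of "x @ [Star]"] by blast
    from unary_statementsI[OF this \<open>list_code w\<close>, of n]
    have "str ((Box # Star # x @ [Star]) @ Sym_p # accents (Suc n) @ w) \<in> str ` unary_statements"
      by (rule imageI)
    then show ?thesis by simp
  qed
  have acc1: "[Con Accent] \<in> str ` range (\<lambda>n. accents (Suc n))"
    by (rule image_eqI[of _ _ "accents (Suc 0)"]) (simp add: accents_def, blast)
  have acc2: "str (accents (Suc n)) @ [Con Accent] \<in> str ` range (\<lambda>n. accents (Suc n))" for n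
    by (rule image_eqI[of _ _ "accents (Suc (Suc n))"]) (simp add: accents_Suc(2)[of "Suc n"], blast)
  have lst1: "Con Sym_a # str (accents (Suc n)) \<in> str ` Collect list_code" for n
    by (rule image_eqI[of _ _ "Sym_a # accents (Suc n)"]) (simp, blast intro: list_code.Con)
  have lst2: "Con Sym_a # str (accents (Suc n)) @ Con U_LPar # str w @ [Con U_RPar] \<in> str ` Collect list_code"
    if "list_code w" for n w
    by (rule image_eqI[of _ _ "Sym_a # accents (Suc n) @ [U_LPar] @ w @ [U_RPar]"])
      (simp, blast intro: list_code.App that)
  have lst3: "str v @ str w \<in> str ` Collect list_code" if "list_code v" "list_code w" for v w
    by (rule image_eqI[of _ _ "v @ w"]) (simp, blast intro: list_code.append that)
  have A: "horn ?M (inst_rf \<sigma> (Prime (Pred (?e+1) [[Con Accent]])))"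
    "horn ?M (inst_rf \<sigma> (Imp (Pred (?e+1) [[Var 0]]) (Prime (Pred (?e+1) [[Var 0, Con Accent]]))))"
    subgoal using acc1 by (simp add: K' I del: One_nat_def add_2_eq_Suc')
    subgoal using acc2 by (auto simp: K' I simp del: One_nat_def add_2_eq_Suc')
    done
  have L: "horn ?M (inst_rf \<sigma> (Imp (Pred (?e+1) [[Var 0]]) (Prime (Pred (?e+2) [[Con Sym_a, Var 0]]))))"
    "horn ?M (inst_rf \<sigma> (Imp (Pred (?e+1) [[Var 0]]) (Imp (Pred (?e+2) [[Var 1]])
       (Prime (Pred (?e+2) [[Con Sym_a, Var 0, Con U_LPar, Var 1, Con U_RPar]])))))"
    "horn ?M (inst_rf \<sigma> (Imp (Pred (?e+2) [[Var 0]]) (Imp (Pred (?e+2) [[Var 1]])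
       (Prime (Pred (?e+2) [[Var 0, Var 1]])))))"
    subgoal using lst1 by (auto simp: K' I simp del: One_nat_def add_2_eq_Suc')
    subgoal using lst2 by (auto simp: K' I simp del: One_nat_def add_2_eq_Suc')
    subgoal using lst3 by (auto simp: K' I simp del: One_nat_def add_2_eq_Suc')
    done
  have S: "horn ?M (inst_rf \<sigma> (Imp (Pred (?e+4) [[Var 0]]) (Imp (Pred \<Omega> [Var 0 # str (Star # tautology)])
       (Imp (Pred (?e+1) [[Var 1]]) (Imp (Pred (?e+2) [[Var 2]])
         (Prime (Pred (?e+5) [[Var 0, Con Star, Con Sym_p, Var 1, Var 2]])))))))"
    "horn ?M (inst_rf \<sigma> (Imp (Pred (?e+3) [[Var 0]])
       (Imp (Pred \<Omega> [Con Accent # Con Star # Var 0 # str (Star # tautology)])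
       (Imp (Pred (?e+1) [[Var 1]]) (Imp (Pred (?e+2) [[Var 2]])
         (Prime (Pred (?e+5) [[Con Box, Con Star, Var 0, Con Star, Con Sym_p, Var 1, Var 2]])))))))"
    subgoal using stmt1 by (auto simp: K' I M simp del: One_nat_def add_2_eq_Suc')
    subgoal using stmt2 by (auto simp: K' I M simp del: One_nat_def add_2_eq_Suc')
    done
  have Th: "horn ?M (inst_rf \<sigma> (Imp (Pred (?e+5) [[Var 0]]) (Imp (Pred \<Omega> [[Var 0]]) (Prime (Pred (?e+6) [[Var 0]])))))"
    by (auto simp: K' I M unary_theorems_iff)
  have W: "horn ?M (inst_rf \<sigma> G)"
    if "G \<in> set (word_rules (?e+3) (filter (\<lambda>c. c \<noteq> Sym_a) A11)) \<or> G \<in> set (word_rules (?e+4) A11)"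
  proof -
    have "set (filter (\<lambda>c. c \<noteq> Sym_a) A11) = set A11 - {Sym_a}" by auto
    then show ?thesis
      using that word[of "?e+3" "filter (\<lambda>c. c \<noteq> Sym_a) A11"] word[of "?e+4" A11]
      unfolding K' I by metis
  qed
  show ?thesis
    using assms A L S Th W
    unfolding statement_rules_def set_append list.set Un_iff insert_iff empty_iff
    by (elim disjE FalseE) (simp_all only: A L S Th W simp_thms)
qed

lemma statement_system_sound:
  assumes "der (statement_system S11 \<Omega>) (Pred (fresh_pred S11 + Suc i) [l])" "elem_list l"
  shows "statement_interp S11 \<Omega> (fresh_pred S11 + Suc i) [l]"
proof -
  have "ext_model S11 (statement_interp S11 \<Omega>) (Pred (fresh_pred S11 + Suc i) [l])"
    by (rule eq_free_ext_sound[OF universal_system_facts(1,3) statement_rules_valid])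
      (use assms in \<open>auto simp: statement_system_def\<close>)
  then show ?thesis
    using fresh_pred_notin[of "fresh_pred S11 + Suc i" S11] by (auto simp: ext_model_def split: if_splits)
qed

lemma recursive_statement_system: "recursive_system (statement_system S11 \<Omega>)"
  unfolding statement_system_def
proof (rule recursive_system_eq_free_ext[OF universal_system_facts(1)])
  fix G
  let ?e = "fresh_pred S11" and ?T = "eq_free_ext S11 6 (statement_rules (fresh_pred S11) \<Omega>)"
  assume G: "G \<in> set (statement_rules (fresh_pred S11) \<Omega>)"
  have p: "\<Omega> \<in> set (prds ?T)" "?e + 1 \<in> set (prds ?T)" "?e + 2 \<in> set (prds ?T)" "?e + 3 \<in> set (prds ?T)"
    "?e + 4 \<in> set (prds ?T)" "?e + 5 \<in> set (prds ?T)" "?e + 6 \<in> set (prds ?T)"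
    using universal_system_facts(4) by (simp_all add: prds_eq_free_ext del: upt_Suc)
  have a: "set (alph ?T) = set A11" using universal_system_facts(2) by simp
  have l: "list_over (set A11) l" if "l \<noteq> []" "\<forall>t\<in>set l. (\<exists>x. t = Var x) \<or> (\<exists>c\<in>set A11. t = Con c)" for l
    using that by (auto simp: list_over_def)
  have "rformula_of ?T G" if "G \<in> set (word_rules q cs)" "q \<in> set (prds ?T)" "set cs \<subseteq> set A11" for q cs
  proof -
    from that(1,3) obtain c where "c \<in> set A11"
      "G = Prime (Pred q [[Con c]]) \<or> G = Imp (Pred q [[Var 0]]) (Prime (Pred q [[Var 0, Con c]]))"
      unfolding word_rules_def by fastforce
    then show ?thesis using that(2) by (auto simp: a list_over_def simp del: alph_eq_free_ext)
  qed
  from this[of "?e + 3" "filter (\<lambda>c. c \<noteq> Sym_a) A11"] this[of "?e + 4" A11]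
  have W: "rformula_of ?T G"
    if "G \<in> set (word_rules (?e+3) (filter (\<lambda>c. c \<noteq> Sym_a) A11)) \<or> G \<in> set (word_rules (?e+4) A11)"
    using that p by auto
  have A: "Sym_a \<in> set A11" "Sym_p \<in> set A11" "Box \<in> set A11" "Accent \<in> set A11" "Star \<in> set A11"
    "U_LPar \<in> set A11" "U_RPar \<in> set A11" "set tautology \<subseteq> set A11"
    by (simp_all add: set_A11 tautology_def)
  then have t: "\<forall>c\<in>set tautology. c \<in> set A11" by blast
  show "rformula_of ?T G"
    using G[unfolded statement_rules_def set_append list.set Un_iff insert_iff empty_iff]
    by (elim disjE FalseE)
      (simp_all only: W simp_thms,
       simp_all add: p a A t list_over_def del: alph_eq_free_ext One_nat_def add_2_eq_Suc')
qed

section \<open>Completeness of the statement rules\<close>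

context
  fixes T e
  defines "T \<equiv> statement_system S11 \<Omega>" and "e \<equiv> fresh_pred S11"
begin

text \<open>No rule has more than three variables, so three words give every instance
  needed.\<close>

lemma rule_inst:
  assumes "G \<in> set (statement_rules e \<Omega>)"
    and "x \<noteq> []" "set x \<subseteq> set A11" "y \<noteq> []" "set y \<subseteq> set A11" "z \<noteq> []" "set z \<subseteq> set A11"
  shows "horn (der T) (inst_rf (\<lambda>i. if i = 0 then str x else if i = 1 then str y else str z) G)"
proof (rule der_rule)
  show "G \<in> set (basis T)"
    using assms(1) by (simp add: T_def e_def statement_system_def eq_free_ext_def)
  show "ground_subst (set (alph T)) (\<lambda>i. if i = 0 then str x else if i = 1 then str y else str z)"
    using assms universal_system_facts(2) by (auto simp: T_def statement_system_def ground_subst_def intro!: ground_over_str)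
qed

lemma der_word:
  assumes "set (word_rules q cs) \<subseteq> set (statement_rules e \<Omega>)" "set cs \<subseteq> set A11"
    "z \<noteq> []" "set z \<subseteq> set cs"
  shows "der T (Pred q [str z])"
  using assms(3,4)
proof (induction z rule: rev_induct)
  case (snoc c z)
  then have c: "[c] \<noteq> []" "set [c] \<subseteq> set A11" using assms(2) by auto
  show ?case
  proof (cases "z = []")
    case True
    have "Prime (Pred q [[Con c]]) \<in> set (statement_rules e \<Omega>)"
      using assms(1) snoc.prems by (auto simp: word_rules_def)
    from rule_inst[OF this c c c] True show ?thesis by simp
  next
    case False
    have "Imp (Pred q [[Var 0]]) (Prime (Pred q [[Var 0, Con c]])) \<in> set (statement_rules e \<Omega>)"
      using assms(1) snoc.prems by (auto simp: word_rules_def)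
    from rule_inst[OF this False _ c c] False snoc assms(2) show ?thesis by auto
  qed
qed simp

lemma der_accents: "der T (Pred (e + 1) [str (accents (Suc n))])"
proof (induction n)
  case 0
  have "Prime (Pred (e+1) [[Con Accent]]) \<in> set (statement_rules e \<Omega>)"
    by (simp add: statement_rules_def)
  \<comment> \<open>The rule has no variables; \<open>[Star]\<close> is merely some nonempty
    word.\<close>
  from rule_inst[OF this, of "[Star]" "[Star]" "[Star]"] show ?case
    by (simp add: accents_def set_A11)
next
  case (Suc n)
  have *: "Imp (Pred (e+1) [[Var 0]]) (Prime (Pred (e+1) [[Var 0, Con Accent]])) \<in> set (statement_rules e \<Omega>)"
    by (simp add: statement_rules_def)
  have "set (accents (Suc n)) \<subseteq> set A11" using set_accents by (auto simp: set_A11)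
  with rule_inst[OF *, of "accents (Suc n)" "[Star]" "[Star]"] Suc show ?case
    by (simp add: accents_Suc(2)[of "Suc n"] set_A11) (simp add: accents_def)
qed

lemma accents_word: "accents (Suc n) \<noteq> []" "set (accents n) \<subseteq> set A11"
  using set_accents by (auto simp: set_A11 accents_def)

lemma list_code_word: "list_code w \<Longrightarrow> w \<noteq> []"
  by (induction rule: list_code.induct) auto

lemma der_list_code: "list_code w \<Longrightarrow> der T (Pred (e + 2) [str w])"
proof (induction rule: list_code.induct)
  case (Con n)
  have *: "Imp (Pred (e+1) [[Var 0]]) (Prime (Pred (e+2) [[Con Sym_a, Var 0]])) \<in> set (statement_rules e \<Omega>)"
    by (simp add: statement_rules_def)
  from rule_inst[OF * accents_word accents_word accents_word] der_accents show ?case by simp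
next
  case (App w n)
  have *: "Imp (Pred (e+1) [[Var 0]]) (Imp (Pred (e+2) [[Var 1]])
       (Prime (Pred (e+2) [[Con Sym_a, Var 0, Con U_LPar, Var 1, Con U_RPar]]))) \<in> set (statement_rules e \<Omega>)"
    by (simp add: statement_rules_def)
  note w = list_code_word[OF App.hyps] set_list_code[OF App.hyps]
  from rule_inst[OF * accents_word w w] der_accents App show ?case by simp
next
  case (append v w)
  have *: "Imp (Pred (e+2) [[Var 0]]) (Imp (Pred (e+2) [[Var 1]]) (Prime (Pred (e+2) [[Var 0, Var 1]])))
      \<in> set (statement_rules e \<Omega>)"
    by (simp add: statement_rules_def)
  note v = list_code_word[OF append.hyps(1)] set_list_code[OF append.hyps(1)]
  note w = list_code_word[OF append.hyps(2)] set_list_code[OF append.hyps(2)]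
  from rule_inst[OF * v w w] append show ?case by simp
qed

lemma der_Omega: "der S11 (Pred \<Omega> [str z]) \<Longrightarrow> der T (Pred \<Omega> [str z])"
  unfolding T_def statement_system_def
  by (rule eq_free_ext_complete[OF universal_system_facts(1,3)]) (auto simp: elem_list_def)

lemma der_statement:
  assumes "z \<in> unary_statements"
  shows "der T (Pred (e + 5) [str z])"
proof -
  obtain S n w where S: "recursive_system S" and w: "list_code w"
    and z: "z = basis_string S @ Sym_p # accents (Suc n) @ w"
    using assms by (auto simp: unary_statements_eq)
  note w' = list_code_word[OF w] set_list_code[OF w]
  note dw = der_accents[of n] der_list_code[OF w]
  show ?thesis
  proof (cases "alph S = []")
    case False
    obtain x where x: "basis_string S = x @ [Star]" "x \<noteq> []" "set x \<subseteq> set A11"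
      using basis_string_snoc by blast
    then have O: "der T (Pred \<Omega> [str (x @ Star # tautology)])"
      using False S by (intro der_Omega) (subst universal_tautology_iff[OF U], auto)
    have W: "der T (Pred (e + 4) [str x])"
      by (rule der_word[of _ A11]) (use x in \<open>auto simp: statement_rules_def\<close>)
    have *: "Imp (Pred (e+4) [[Var 0]]) (Imp (Pred \<Omega> [Var 0 # str (Star # tautology)])
       (Imp (Pred (e+1) [[Var 1]]) (Imp (Pred (e+2) [[Var 2]])
         (Prime (Pred (e+5) [[Var 0, Con Star, Con Sym_p, Var 1, Var 2]]))))) \<in> set (statement_rules e \<Omega>)"
      by (simp add: statement_rules_def)
    from rule_inst[OF * x(2,3) accents_word w'] O W dw show ?thesis by (simp add: z x)
  next
    case True
    \<comment> \<open>\<open>x\<close> lies between the tally of the empty alphabet, with its star,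
      and the final star. It contains the star in front of the axioms and is therefore nonempty, as
      lists must be.\<close>
    obtain x where x: "basis_string S = Box # Star # x @ [Star]" "x \<noteq> []"
    proof -
      obtain v where "code_basis S (basis S) = v @ [Star]" using code_basis_snoc by blast
      then show ?thesis
        using that[of "tally (length (prds S)) @ Star # v"] True by (simp add: basis_string_eq tally_def[of 0])
    qed
    then have x': "Sym_a \<notin> set x" "\<exists>S. recursive_system S \<and> alph S \<noteq> [] \<and> basis_string S = Accent # Star # x @ [Star]"
      using basis_string_empty_alph_iff[of "x @ [Star]"] S True by auto
    have x'': "set x \<subseteq> set A11" using set_basis_string[of S] x by (auto simp: set_A11)
    then have "set (Accent # Star # x) \<subseteq> set A11" by (auto simp: set_A11)
    then have O: "der T (Pred \<Omega> [str ((Accent # Star # x) @ Star # tautology)])"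
      using x' by (intro der_Omega) (subst universal_tautology_iff[OF U], auto)
    have W: "der T (Pred (e + 3) [str x])"
      by (rule der_word[of _ "filter (\<lambda>c. c \<noteq> Sym_a) A11"])
        (use x(2) x'(1) x'' in \<open>auto simp: statement_rules_def\<close>)
    have *: "Imp (Pred (e+3) [[Var 0]]) (Imp (Pred \<Omega> [Con Accent # Con Star # Var 0 # str (Star # tautology)])
       (Imp (Pred (e+1) [[Var 1]]) (Imp (Pred (e+2) [[Var 2]])
         (Prime (Pred (e+5) [[Con Box, Con Star, Var 0, Con Star, Con Sym_p, Var 1, Var 2]])))))
       \<in> set (statement_rules e \<Omega>)"
      by (simp add: statement_rules_def)
    from rule_inst[OF * x(2) x'' accents_word w'] O W dw show ?thesis by (simp add: z x)
  qed
qed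

lemma der_theorem:
  assumes "z \<in> unary_theorems S11 \<Omega>"
  shows "der T (Pred (e + 6) [str z])"
proof -
  have z: "z \<in> unary_statements" "der S11 (Pred \<Omega> [str z])" using assms by (auto simp: unary_theorems_iff)
  have *: "Imp (Pred (e+5) [[Var 0]]) (Imp (Pred \<Omega> [[Var 0]]) (Prime (Pred (e+6) [[Var 0]])))
      \<in> set (statement_rules e \<Omega>)"
    by (simp add: statement_rules_def)
  note w = set_unary_statements[OF z(1), THEN conjunct1] set_unary_statements[OF z(1), THEN conjunct2]
  from rule_inst[OF * w w w] der_statement[OF z(1)] der_Omega[OF z(2)] show ?thesis by simp
qed

end

theorem re_unary_statements: "re_strings unary_statements"
  and re_unary_theorems: "re_strings (unary_theorems S11 \<Omega>)"
proof -
  let ?T = "statement_system S11 \<Omega>" and ?e = "fresh_pred S11"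
  have re: "re_strings L"
    if i: "i < 6" and complete: "\<And>z. z \<in> L \<Longrightarrow> der ?T (Pred (?e + Suc i) [str z])"
      and sound: "\<And>l. statement_interp S11 \<Omega> (?e + Suc i) [l] \<Longrightarrow> \<exists>z\<in>L. l = str z" for i L
    unfolding recursively_enumerable_def
  proof (intro exI conjI)
    show "recursive_system ?T" by (rule recursive_statement_system)
    show "?e + Suc i \<in> set (prds ?T)"
      using i by (simp add: statement_system_def prds_eq_free_ext del: upt_Suc)
    \<comment> \<open>The model also excludes elementary lists with applications, since the atoms
      true in it have strings as arguments.\<close>
    show "(\<lambda>z. [str z]) ` L = {ls. length ls = 1 \<and> (\<forall>l\<in>set ls. elem_list l) \<and> der ?T (Pred (?e + Suc i) ls)}"
      using complete sound[OF statement_system_sound]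
      by (fastforce simp: length_Suc_conv elem_list_def)
  qed
  have e: "?e + 5 = ?e + Suc 4" "?e + 6 = ?e + Suc 5" by auto
  show "re_strings unary_statements"
  proof (rule re[of 4])
    show "der ?T (Pred (?e + Suc 4) [str z])" if "z \<in> unary_statements" for z
      using der_statement[OF that] unfolding e .
  qed (auto simp: statement_interp_def)
  show "re_strings (unary_theorems S11 \<Omega>)"
  proof (rule re[of 5])
    show "der ?T (Pred (?e + Suc 5) [str z])" if "z \<in> unary_theorems S11 \<Omega>" for z
      using der_theorem[OF that] unfolding e .
  qed (auto simp: statement_interp_def)
qed

end

section \<open>The complement is not recursively enumerable\<close>

definition code_letters :: "csym list \<Rightarrow> csym list \<Rightarrow> csym list" where
  "code_letters A z = concat (map (\<lambda>c. Sym_a # accents (posn A c)) z)"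

lemma code_list_str: "code_list S (str z) = code_letters (alph S) z"
  by (induction z) (auto simp: code_letters_def)

lemma code_letters_word: "z \<noteq> [] \<Longrightarrow> code_letters A z \<noteq> []" "set (code_letters A z) \<subseteq> set A11"
proof -
  show "z \<noteq> [] \<Longrightarrow> code_letters A z \<noteq> []" by (cases z) (auto simp: code_letters_def)
  have "Sym_a \<in> set A11" by (simp add: set_A11)
  then show "set (code_letters A z) \<subseteq> set A11"
    using set_accents_A11 unfolding code_letters_def by (induction z) simp_all
qed

text \<open>
  Let \<open>p\<close> of \<open>S\<close> represent a set \<open>C\<close>. With \<open>e = fresh_pred S\<close>, the predicate \<open>e + 1\<close>
  relates a string to its code, and \<open>q = e + 2\<close>, the last predicate of the new system,
  holds of \<open>z\<close> iff \<open>C\<close> contains \<open>z\<close> followed by the code of \<open>q z\<close>.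
\<close>

definition diagonal_word :: "recsys \<Rightarrow> csym list" where
  "diagonal_word S = Sym_p # accents (length (prds S) + 3)"

text \<open>There is no circularity in rules that mention the code of their own predicate:
  \<open>diagonal_word S\<close> and \<open>code_letters (alph S)\<close> depend only on the number
  of predicates of \<open>S\<close> and on its alphabet, which the extension keeps.\<close>

definition diagonal_rules :: "recsys \<Rightarrow> nat \<Rightarrow> rformula list" where
  "diagonal_rules S p = (let e = fresh_pred S in
     map (\<lambda>c. Prime (Pred (e + 1) [[Con c], str (code_letters (alph S) [c])])) A11 @
     map (\<lambda>c. Imp (Pred (e + 1) [[Var 0], [Var 1]])
       (Prime (Pred (e + 1) [[Var 0, Con c], Var 1 # str (code_letters (alph S) [c])]))) A11 @
     [Imp (Pred (e + 1) [[Var 0], [Var 1]]) (Imp (Pred p [Var 0 # str (diagonal_word S) @ [Var 1]])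
       (Prime (Pred (e + 2) [[Var 0]])))])"

definition diagonal_system :: "recsys \<Rightarrow> nat \<Rightarrow> recsys" where
  "diagonal_system S p = eq_free_ext S 2 (diagonal_rules S p)"

definition diagonal_interp :: "recsys \<Rightarrow> nat \<Rightarrow> nat \<Rightarrow> item list list \<Rightarrow> bool" where
  "diagonal_interp S p r ls \<longleftrightarrow> (\<exists>z. z \<noteq> [] \<and> set z \<subseteq> set A11 \<and>
     (if r = fresh_pred S + 1 then ls = [str z, str (code_letters (alph S) z)]
      else ls = [str z] \<and> der S (Pred p [str (z @ diagonal_word S @ code_letters (alph S) z)])))"

lemma alph_diagonal_system [simp]: "alph (diagonal_system S p) = alph S"
  by (simp add: diagonal_system_def)

context
  fixes S p
  assumes S: "recursive_system S" and p: "p \<in> set (prds S)" and A11: "set A11 \<subseteq> set (alph S)"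
begin

lemma alph_nonempty: "alph S \<noteq> []"
  using A11 by (auto simp: set_A11)

lemma set_word: "set (code_letters (alph S) z) \<subseteq> set (alph S)" "set (diagonal_word S) \<subseteq> set (alph S)"
  using code_letters_word(2)[of "alph S" z] set_accents_A11[of "length (prds S) + 3"] A11
  by (auto simp: diagonal_word_def set_A11)

lemma diagonal_prds: "p \<in> set (prds (diagonal_system S p))" "fresh_pred S + 1 \<in> set (prds (diagonal_system S p))"
   "fresh_pred S + 2 \<in> set (prds (diagonal_system S p))"
  using p by (simp_all add: diagonal_system_def prds_eq_free_ext del: upt_Suc)

lemma recursive_diagonal_system: "recursive_system (diagonal_system S p)"
  unfolding diagonal_system_def
proof (rule recursive_system_eq_free_ext[OF S])
  fix G
  assume G: "G \<in> set (diagonal_rules S p)"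
  have w: "\<forall>c\<in>set A11. c \<in> set (alph S)" "\<forall>c\<in>set (code_letters (alph S) z). c \<in> set (alph S)"
    "\<forall>c\<in>set (diagonal_word S). c \<in> set (alph S)" for z
    using A11 set_word by blast+
  have "rformula_of (diagonal_system S p) G"
    using G diagonal_prds w
    by (auto simp: diagonal_rules_def Let_def list_over_def code_letters_word(1)
        simp del: One_nat_def add_2_eq_Suc')
  then show "rformula_of (eq_free_ext S 2 (diagonal_rules S p)) G" by (simp add: diagonal_system_def)
qed

lemma code_diagonal:
  "code_prime (diagonal_system S p) (Pred (fresh_pred S + 2) [l]) = diagonal_word S @ code_list (diagonal_system S p) l"
proof -
  let ?P = "prds (diagonal_system S p)"
  have P: "?P = prds S @ [fresh_pred S, fresh_pred S + 1, fresh_pred S + 2]"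
    by (simp add: diagonal_system_def prds_eq_free_ext upt_rec)
  have "distinct ?P" using recursive_diagonal_system by (simp add: recursive_system_def)
  \<comment> \<open>The third new predicate has index \<open>length (prds S) + 2\<close>; positions
    are counted from 1, whence the 3 in \<open>diagonal_word\<close>.\<close>
  then have "posn ?P (?P ! (length (prds S) + 2)) = Suc (length (prds S) + 2)"
    by (rule posn_nth) (simp add: P)
  moreover have "?P ! (length (prds S) + 2) = fresh_pred S + 2" unfolding P by (simp add: nth_append)
  ultimately show ?thesis by (simp add: diagonal_word_def eval_nat_numeral)
qed

lemma diagonal_rules_valid:
  assumes "G \<in> set (diagonal_rules S p)"
  shows "horn (ext_model S (diagonal_interp S p)) (inst_rf \<sigma> G)"
proof -
  let ?e = "fresh_pred S" and ?M = "ext_model S (diagonal_interp S p)" and ?c = "code_letters (alph S)"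
  have M: "?M (Pred p ls) \<longleftrightarrow> der S (Pred p ls)" for ls
    using fresh_pred_notin[OF p] p by (simp add: ext_model_def)
  have n: "?e + 1 \<notin> set (prds S)" "?e + 2 \<notin> set (prds S)"
    using fresh_pred_notin[of _ S] by fastforce+
  have K: "?M (Pred (?e + 1) [l, m]) \<longleftrightarrow> (\<exists>z. z \<noteq> [] \<and> set z \<subseteq> set A11 \<and> l = str z \<and> m = str (?c z))"
    "?M (Pred (?e + 2) [l]) \<longleftrightarrow> (\<exists>z. z \<noteq> [] \<and> set z \<subseteq> set A11 \<and> l = str z \<and>
        der S (Pred p [str (z @ diagonal_word S @ ?c z)]))" for l m
    using n by (simp_all add: ext_model_def diagonal_interp_def)
  from assms consider c where "c \<in> set A11" "G = Prime (Pred (?e + 1) [[Con c], str (?c [c])])"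
    | c where "c \<in> set A11" "G = Imp (Pred (?e + 1) [[Var 0], [Var 1]])
       (Prime (Pred (?e + 1) [[Var 0, Con c], Var 1 # str (?c [c])]))"
    | "G = Imp (Pred (?e + 1) [[Var 0], [Var 1]]) (Imp (Pred p [Var 0 # str (diagonal_word S) @ [Var 1]])
       (Prime (Pred (?e + 2) [[Var 0]])))"
    unfolding diagonal_rules_def Let_def by fastforce
  then show ?thesis
  proof cases
    case 1
    then show ?thesis by (auto simp: K simp del: One_nat_def intro!: exI[of _ "[c]"])
  next
    case 2
    have "\<exists>z'. z' \<noteq> [] \<and> set z' \<subseteq> set A11 \<and> str z @ [Con c] = str z' \<and> str (?c z) @ str (?c [c]) = str (?c z')"
      if "set z \<subseteq> set A11" for z
      using that 2(1) by (intro exI[of _ "z @ [c]"]) (auto simp: code_letters_def)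
    then show ?thesis unfolding 2(2) by (auto simp: K simp del: One_nat_def)
  next
    case 3
    show ?thesis unfolding 3 by (auto simp: K M simp del: One_nat_def add_2_eq_Suc')
  qed
qed

text \<open>In the model, \<open>fresh_pred S + 1\<close> is the graph of the coding of words, so
  the second variable of the last rule can only be the code of the first. Equations of
  \<open>S\<close> cannot blur this graph, as they do not act on new predicates.\<close>

theorem diagonal_iff:
  assumes z: "z \<noteq> []" "set z \<subseteq> set A11"
  shows "der (diagonal_system S p) (Pred (fresh_pred S + 2) [str z]) \<longleftrightarrow>
    der S (Pred p [str (z @ diagonal_word S @ code_letters (alph S) z)])"
    (is "?L \<longleftrightarrow> ?R")
proof
  assume ?L
  then have "ext_model S (diagonal_interp S p) (Pred (fresh_pred S + 2) [str z])"
    by (intro eq_free_ext_sound[OF S alph_nonempty diagonal_rules_valid])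
      (auto simp: diagonal_system_def elem_list_def)
  moreover have "fresh_pred S + 2 \<notin> set (prds S)"
    using fresh_pred_notin[of _ S] by fastforce
  moreover have "inj (map Con)" by (simp add: inj_on_def)
  ultimately show ?R
    by (auto simp: ext_model_def diagonal_interp_def dest!: map_injective[OF _ injI, rotated])
next
  let ?D = "diagonal_system S p" and ?c = "code_letters (alph S)"
  assume ?R
  then have R: "der ?D (Pred p [str (z @ diagonal_word S @ ?c z)])"
    unfolding diagonal_system_def
    by (intro eq_free_ext_complete[OF S alph_nonempty]) (auto simp: elem_list_def)
  have rule: "horn (der ?D) (inst_rf (\<lambda>i. if i = 0 then str x else str y) G)"
    if "G \<in> set (diagonal_rules S p)" "x \<noteq> []" "set x \<subseteq> set A11" "y \<noteq> []" "set y \<subseteq> set A11" for G x y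
  proof (rule der_rule)
    show "G \<in> set (basis ?D)" using that(1) by (simp add: diagonal_system_def eq_free_ext_def)
    show "ground_subst (set (alph ?D)) (\<lambda>i. if i = 0 then str x else str y)"
      using that A11 by (auto simp: ground_subst_def intro!: ground_over_str)
  qed
  have C: "der ?D (Pred (fresh_pred S + 1) [str z, str (?c z)])"
    using z
  proof (induction z rule: rev_induct)
    case (snoc c z)
    show ?case
    proof (cases "z = []")
      case True
      have "Prime (Pred (fresh_pred S + 1) [[Con c], str (?c [c])]) \<in> set (diagonal_rules S p)"
        using snoc.prems by (auto simp: diagonal_rules_def Let_def)
      from rule[OF this, of "[Star]" "[Star]"] True show ?thesis by (simp add: set_A11)
    next
      case False
      have "Imp (Pred (fresh_pred S + 1) [[Var 0], [Var 1]])
         (Prime (Pred (fresh_pred S + 1) [[Var 0, Con c], Var 1 # str (?c [c])])) \<in> set (diagonal_rules S p)"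
        using snoc.prems by (auto simp: diagonal_rules_def Let_def)
      from rule[OF this False _ code_letters_word(1)[OF False] code_letters_word(2)] snoc False
      show ?thesis by (simp add: code_letters_def)
    qed
  qed simp
  have "Imp (Pred (fresh_pred S + 1) [[Var 0], [Var 1]]) (Imp (Pred p [Var 0 # str (diagonal_word S) @ [Var 1]])
       (Prime (Pred (fresh_pred S + 2) [[Var 0]]))) \<in> set (diagonal_rules S p)"
    by (simp add: diagonal_rules_def Let_def)
  from rule[OF this z code_letters_word(1)[OF z(1)] code_letters_word(2)] C R show ?L by simp
qed

end

text \<open>A representing system may have any alphabet. An element of the complement in which all
  eleven symbols occur forces \<open>A11\<close> into it.\<close>

lemma nontheorem_with_all_symbols:
  assumes U: "universal_system S11 \<Omega>"
  shows "\<exists>z \<in> unary_statements - unary_theorems S11 \<Omega>. set z = set A11"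
proof -
  \<comment> \<open>The axiom contributes \<open>U_Arrow\<close>, \<open>U_Sim\<close>,
    \<open>U_Comma\<close> and \<open>Sym_v\<close>, the empty alphabets contribute
    \<open>Box\<close>, and the formula \<open>p_1 a_1(a_1)\<close> contributes
    \<open>Sym_p\<close>, \<open>Sym_a\<close> and the parentheses. A system with this basis string
    has no predicates, so the formula is not one of its own.\<close>
  define S where "S = \<lparr>alph = [], prds = [],
    basis = [Imp (Equ [Var 0] [Var 0]) (Prime (Equ [Var 0] [Var 0]))]\<rparr>"
  define w where "w = Sym_a # accents (Suc 0) @ [U_LPar] @ (Sym_a # accents (Suc 0)) @ [U_RPar]"
  define x where "x = Sym_p # accents (Suc 0) @ w"
  have rs: "recursive_system S" by (simp add: S_def recursive_system_def)
  have "list_code w" unfolding w_def by (intro list_code.App list_code.Con)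
  then have stmt: "basis_string S @ x \<in> unary_statements"
    unfolding x_def by (intro unary_statementsI[OF rs]) auto
  have set: "set (basis_string S @ x) = set A11"
    by (auto simp: basis_string_def S_def x_def w_def tally_def accents_def set_A11)
  have "\<not> der S11 (Pred \<Omega> [str (basis_string S @ x)])"
  proof
    assume "der S11 (Pred \<Omega> [str (basis_string S @ x)])"
    then obtain T F where T: "basis_string S @ x = basis_string T @ code_prime T F" "prime_of T F"
      using U set unfolding universal_system_def by blast
    have "Star \<notin> set x" by (simp add: x_def w_def accents_def)
    from split_statement[OF T(1) this code_prime_no_Star]
    have *: "basis_string S = basis_string T" "x = code_prime T F" by auto
    from *(2) obtain p ls where "F = Pred p ls" by (cases F) (auto simp: x_def)
    with T(2) have "prds T \<noteq> []" by auto
    with basis_string_inj(2)[OF *(1)] show False by (simp add: S_def)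
  qed
  with stmt have "basis_string S @ x \<in> unary_statements - unary_theorems S11 \<Omega>"
    by (simp add: unary_theorems_iff)
  with set show ?thesis by blast
qed

theorem not_re_complement:
  assumes U: "universal_system S11 \<Omega>"
  shows "\<not> re_strings (unary_statements - unary_theorems S11 \<Omega>)"
proof
  let ?C = "unary_statements - unary_theorems S11 \<Omega>"
  assume "re_strings ?C"
  then obtain S p where S: "recursive_system S" "p \<in> set (prds S)"
    and C: "(\<lambda>z. [str z]) ` ?C = {ls. length ls = 1 \<and> (\<forall>l\<in>set ls. elem_list l) \<and> der S (Pred p ls)}"
    unfolding recursively_enumerable_def by blast
  have inj: "inj (\<lambda>z. [str z])" by (rule injI) (auto dest: map_injective intro: injI)
  have C: "der S (Pred p [str z]) \<longleftrightarrow> z \<in> ?C" for z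
  proof -
    have "z \<in> ?C \<longleftrightarrow> [str z] \<in> (\<lambda>z. [str z]) ` ?C"
      using inj_image_mem_iff[OF inj, of z ?C] by blast
    then show ?thesis unfolding C by (simp add: elem_list_def)
  qed
  obtain z0 where z0: "z0 \<in> ?C" "set z0 = set A11"
    using nontheorem_with_all_symbols[OF U] by blast
  have "rformula_of S (Prime (Pred p [str z0]))"
    by (rule R_derivable_rformula_of[OF S(1)]) (use C z0(1) in blast)
  then have A11: "set A11 \<subseteq> set (alph S)" using z0(2) by (auto simp: list_over_def)
  let ?D = "diagonal_system S p" and ?q = "fresh_pred S + 2"
  let ?d = "basis_string ?D" and ?F = "Pred ?q [str (basis_string ?D)]"
  note D = recursive_diagonal_system[OF S A11]
  have d: "?d \<noteq> []" "set ?d \<subseteq> set A11"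
    using basis_string_snoc[of ?D] set_basis_string[of ?D] by auto
  have F: "prime_of ?D ?F" "elem_prime ?F"
    using diagonal_prds(3)[OF S A11] d A11 by (auto simp: list_over_def elem_list_def simp del: add_2_eq_Suc')
  \<comment> \<open>By the diagonal rule \<open>?z\<close> lies in the complement iff
    \<open>der ?D ?F\<close>, and by \<open>universal_iff\<close> it is a theorem under the same
    condition; yet a unary statement belongs to exactly one of the two sets.\<close>
  let ?z = "?d @ code_prime ?D ?F"
  have "der ?D ?F \<longleftrightarrow> ?z \<in> ?C"
    unfolding code_diagonal[OF S A11] code_list_str alph_diagonal_system
    by (simp only: diagonal_iff[OF S A11 d] C)
  moreover have "?z \<in> unary_statements"
  proof -
    have "statement_of ?z ?D ?D ?F"
      using D F by (simp add: statement_of_def del: code_prime.simps prime_of.simps elem_prime.simps)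
    then show ?thesis unfolding unary_statements_def by blast
  qed
  moreover have "der S11 (Pred \<Omega> [str ?z]) \<longleftrightarrow> der ?D ?F"
    by (rule universal_iff[OF U D F])
  ultimately show False by (simp add: unary_theorems_iff)
qed

theorem mainTheorem3:
  fixes S11 :: recsys and \<Omega> :: nat
  assumes "universal_system S11 \<Omega>"
  shows "re_strings unary_statements \<and>
         re_strings (unary_theorems S11 \<Omega>) \<and>
         \<not> re_strings (unary_statements - unary_theorems S11 \<Omega>)"
  using re_unary_statements[OF assms] re_unary_theorems[OF assms] not_re_complement[OF assms]
  by blast

end
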